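(* Every local graph partitioning problem $\mathcal L(\mathrm{goal},\alpha_1,\alpha_2)$ can be solved in time $O^*((\Delta k)^{2k})$, where $\Delta$ is the maximum degree of the input graph and $k$ is the prescribed size of the feasible vertex subsets.
   Context: A local graph partitioning problem $\mathcal L(\mathrm{goal},\alpha_1,\alpha_2)$, with $\mathrm{goal}\in\{\min,\max\}$ and $\alpha_1,\alpha_2\in\mathbb R$, has as input a graph $G=(V,E)$ and two integers $k$ and $p$. Feasible solutions are subsets $V'\subseteq V$ with $|V'|=k$. For $T\subseteq V$, let $E(T)$ be the set of edges with both endpoints in $T$ and $E(T,V\setminus T)$ the set of edges with exactly one endpoint in $T$; the value is $\mathrm{val}(T)=\alpha_1|E(T)|+\alpha_2|E(T,V\setminus T)|$. The question is whether there exists a feasible $V'$ with $\mathrm{val}(V')\ge p$ (if goal $=\max$) or $\mathrm{val}(V')\le p$ (if goal $=\min$). $O^*(\cdot)$ suppresses factors polynomial in the input size. *)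

theory Defs
  imports Complex_Main "HOL-Library.Log_Nat" "HOL-Computational_Algebra.Polynomial"
begin

section \<open>Local graph partitioning\<close>

definition simple_graph :: "'a set \<Rightarrow> 'a set set \<Rightarrow> bool" where
  "simple_graph V E \<longleftrightarrow> finite V \<and> (\<forall>e\<in>E. e \<subseteq> V \<and> card e = 2)"

definition inner_edges :: "'a set set \<Rightarrow> 'a set \<Rightarrow> 'a set set" where
  "inner_edges E T = {e \<in> E. e \<subseteq> T}"

definition cut_edges :: "'a set set \<Rightarrow> 'a set \<Rightarrow> 'a set set" where
  "cut_edges E T = {e \<in> E. card (e \<inter> T) = 1}"

definition degree_of :: "'a set set \<Rightarrow> 'a \<Rightarrow> nat" where
  "degree_of E v = card {e \<in> E. v \<in> e}"

text \<open>The graph without vertices has maximum degree 0.\<close>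

definition max_degree :: "'a set \<Rightarrow> 'a set set \<Rightarrow> nat" where
  "max_degree V E = Max (insert 0 (degree_of E ` V))"

definition lgp_val :: "real \<Rightarrow> real \<Rightarrow> 'a set set \<Rightarrow> 'a set \<Rightarrow> real" where
  "lgp_val \<alpha>1 \<alpha>2 E T =
     \<alpha>1 * real (card (inner_edges E T)) + \<alpha>2 * real (card (cut_edges E T))"

datatype goal = Minimize | Maximize

fun reaches :: "goal \<Rightarrow> real \<Rightarrow> int \<Rightarrow> bool" where
  "reaches Maximize x p \<longleftrightarrow> x \<ge> of_int p"
| "reaches Minimize x p \<longleftrightarrow> x \<le> of_int p"

text \<open>As machine inputs, graphs have vertex set \<open>{..<n}\<close>.\<close>

record lgp_input =
  num_verts :: nat
  edges :: "nat set set"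
  sol_size :: int
  threshold :: int

definition valid_input :: "lgp_input \<Rightarrow> bool" where
  "valid_input I \<longleftrightarrow> simple_graph {..<num_verts I} (edges I)"

definition lgp_yes :: "goal \<Rightarrow> real \<Rightarrow> real \<Rightarrow> lgp_input \<Rightarrow> bool" where
  "lgp_yes g \<alpha>1 \<alpha>2 I \<longleftrightarrow>
     (\<exists>T \<subseteq> {..<num_verts I}. int (card T) = sol_size I \<and>
        reaches g (lgp_val \<alpha>1 \<alpha>2 (edges I) T) (threshold I))"

text \<open>Adjacency matrix, and binary representations of the two integers.\<close>

definition input_size :: "lgp_input \<Rightarrow> nat" where
  "input_size I = num_verts I ^ 2 + nat (bitlen \<bar>sol_size I\<bar>) + nat (bitlen \<bar>threshold I\<bar>)"


section \<open>Random access machine\<close>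

text \<open>
  Programs of a unit-cost RAM with integer variables, an integer memory with
  indirect addressing, and real variables. The latter are needed because
  \<open>\<alpha>1\<close> and \<open>\<alpha>2\<close> are arbitrary reals: comparing \<open>\<alpha>1 * a + \<alpha>2 * b\<close> with an integer
  need not be computable on a machine that works with bit strings only.
  Arithmetic is restricted to addition and subtraction, and there is no
  conversion from reals to integers: unit-cost multiplication or rounding
  would give unrealistic computational power.
\<close>

type_synonym vname = string

datatype iexp = IConst int | IVar vname | IAdd iexp iexp | ISub iexp iexp | Load iexp

datatype rexp = RVar vname | OfInt iexp | RAdd rexp rexp | RSub rexp rexp

datatype test = ILe iexp iexp | RLe rexp rexp | Neg test | Conj test test

datatype com =
    Skip
  | IAssign vname iexp
  | RAssign vname rexp
  | Store iexp iexp
  | Seq com com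
  | Cond test com com
  | Loop test com

record state =
  ivars :: "vname \<Rightarrow> int"
  rvars :: "vname \<Rightarrow> real"
  mem :: "int \<Rightarrow> int"

fun ival :: "iexp \<Rightarrow> state \<Rightarrow> int" where
  "ival (IConst z) s = z"
| "ival (IVar x) s = ivars s x"
| "ival (IAdd a b) s = ival a s + ival b s"
| "ival (ISub a b) s = ival a s - ival b s"
| "ival (Load a) s = mem s (ival a s)"

fun rval :: "rexp \<Rightarrow> state \<Rightarrow> real" where
  "rval (RVar x) s = rvars s x"
| "rval (OfInt a) s = of_int (ival a s)"
| "rval (RAdd a b) s = rval a s + rval b s"
| "rval (RSub a b) s = rval a s - rval b s"

fun tval :: "test \<Rightarrow> state \<Rightarrow> bool" where
  "tval (ILe a b) s \<longleftrightarrow> ival a s \<le> ival b s"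
| "tval (RLe a b) s \<longleftrightarrow> rval a s \<le> rval b s"
| "tval (Neg b) s \<longleftrightarrow> \<not> tval b s"
| "tval (Conj b c) s \<longleftrightarrow> tval b s \<and> tval c s"

text \<open>
  \<open>exec c s t s'\<close>: started in \<open>s\<close>, program \<open>c\<close> terminates in \<open>s'\<close> after \<open>t\<close> steps, where
  a step is an assignment, a store or a test. The expressions occurring in a fixed
  program have constant size, so charging 1 for each of them is accurate up to a
  constant factor.
\<close>

inductive exec :: "com \<Rightarrow> state \<Rightarrow> nat \<Rightarrow> state \<Rightarrow> bool" where
  Skip: "exec Skip s 1 s"
| IAssign: "exec (IAssign x a) s 1 (s\<lparr>ivars := (ivars s)(x := ival a s)\<rparr>)"
| RAssign: "exec (RAssign x a) s 1 (s\<lparr>rvars := (rvars s)(x := rval a s)\<rparr>)"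
| Store: "exec (Store a b) s 1 (s\<lparr>mem := (mem s)(ival a s := ival b s)\<rparr>)"
| Seq: "exec c1 s t1 s' \<Longrightarrow> exec c2 s' t2 s'' \<Longrightarrow> exec (Seq c1 c2) s (t1 + t2) s''"
| CondTrue: "tval b s \<Longrightarrow> exec c1 s t s' \<Longrightarrow> exec (Cond b c1 c2) s (1 + t) s'"
| CondFalse: "\<not> tval b s \<Longrightarrow> exec c2 s t s' \<Longrightarrow> exec (Cond b c1 c2) s (1 + t) s'"
| LoopFalse: "\<not> tval b s \<Longrightarrow> exec (Loop b c) s 1 s"
| LoopTrue: "tval b s \<Longrightarrow> exec c s t1 s' \<Longrightarrow> exec (Loop b c) s' t2 s'' \<Longrightarrow>
    exec (Loop b c) s (1 + t1 + t2) s''"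

inductive_cases exec_elims:
  "exec Skip s t s'"
  "exec (IAssign x a) s t s'"
  "exec (RAssign x a) s t s'"
  "exec (Store a b) s t s'"
  "exec (Seq c1 c2) s t s'"
  "exec (Cond b c1 c2) s t s'"
  "exec (Loop b c) s t s'"

lemma exec_deterministic:
  "exec c s t s' \<Longrightarrow> exec c s u s'' \<Longrightarrow> t = u \<and> s' = s''"
proof (induction arbitrary: u s'' rule: exec.induct)
  case (Seq c1 s t1 s1 c2 t2 s2)
  from exec_elims(5)[OF Seq.prems] obtain v1 v2 r where
    "u = v1 + v2" "exec c1 s v1 r" "exec c2 r v2 s''" by metis
  with Seq.IH show ?case by metis
next
  case (CondTrue b s c1 t s1 c2)
  from exec_elims(6)[OF CondTrue.prems] CondTrue.hyps(1) obtain v where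
    "u = 1 + v" "exec c1 s v s''" by (metis plus_1_eq_Suc)
  with CondTrue.IH show ?case by metis
next
  case (CondFalse b s c2 t s1 c1)
  from exec_elims(6)[OF CondFalse.prems] CondFalse.hyps(1) obtain v where
    "u = 1 + v" "exec c2 s v s''" by (metis plus_1_eq_Suc)
  with CondFalse.IH show ?case by metis
next
  case (LoopFalse b s c)
  from exec_elims(7)[OF LoopFalse.prems] LoopFalse.hyps show ?case by (metis One_nat_def)
next
  case (LoopTrue b s c t1 s1 t2 s2)
  from exec_elims(7)[OF LoopTrue.prems] LoopTrue.hyps(1) obtain v1 v2 r where
    "u = 1 + v1 + v2" "exec c s v1 r" "exec (Loop b c) r v2 s''" by (metis plus_1_eq_Suc add_Suc)
  with LoopTrue.IH show ?case by metis
qed (erule exec_elims; simp)+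


section \<open>Solving a problem in a given time\<close>

text \<open>
  Entry \<open>(i, j)\<close> of the adjacency matrix is stored at address \<open>i * n + j\<close>. The
  coefficients \<open>\<alpha>1\<close> and \<open>\<alpha>2\<close> are the only real constants a program has at its disposal
  besides the integers.
\<close>

definition initial_state :: "real \<Rightarrow> real \<Rightarrow> lgp_input \<Rightarrow> state" where
  "initial_state \<alpha>1 \<alpha>2 I =
     \<lparr>ivars = (\<lambda>_. 0)(''n'' := int (num_verts I), ''k'' := sol_size I, ''p'' := threshold I),
      rvars = (\<lambda>_. 0)(''alpha1'' := \<alpha>1, ''alpha2'' := \<alpha>2),
      mem = (\<lambda>a. if \<exists>i j. i < num_verts I \<and> j < num_verts I \<and> {i, j} \<in> edges I \<and>
                      a = int (i * num_verts I + j)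
                 then 1 else 0)\<rparr>"

text \<open>
  Time \<open>O\<^sup>*(f)\<close>. The maximum with 1 only matters where \<open>f\<close> vanishes (for \<open>f = (\<Delta>k)\<^bsup>2k\<^esup>\<close>:
  graphs without edges); there a running time of 0 cannot be meant.
\<close>

definition solvable_in_O_star :: "goal \<Rightarrow> real \<Rightarrow> real \<Rightarrow> (lgp_input \<Rightarrow> nat) \<Rightarrow> bool" where
  "solvable_in_O_star g \<alpha>1 \<alpha>2 f \<longleftrightarrow>
     (\<exists>(c :: com) (q :: nat poly). \<forall>I. valid_input I \<longrightarrow>
        (\<exists>t s. exec c (initial_state \<alpha>1 \<alpha>2 I) t s \<and>
               ivars s ''out'' = (if lgp_yes g \<alpha>1 \<alpha>2 I then 1 else 0) \<and>
               t \<le> poly q (input_size I) * max 1 (f I)))"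

end

theory Submission
  imports Defs
begin

text \<open>
  Call two vertex sets touching if they share a vertex or are joined by an edge; the value is
  additive over sets that do not touch. First list all sets of size at most \<open>k\<close> obtained from a
  single vertex by repeatedly adding a neighbour; there are about \<open>n (\<Delta>k)\<^bsup>m - 1\<^esup>\<close> of size \<open>m\<close>.
  Then grow partial solutions \<open>S\<close> from the empty set, one vertex at a time: for each size
  \<open>i \<le> k - |S|\<close> let \<open>B\<close> be a listed set of size \<open>i\<close> that does not touch \<open>S\<close> and has the best value, and
  branch on all vertices that belong to \<open>B\<close> or are adjacent to \<open>S \<union> B\<close>. If \<open>S\<close> extends to a solution
  \<open>T\<close> containing none of these vertices, then a connected component of \<open>T - S\<close> of size \<open>i\<close> can be
  replaced by the best \<open>B\<close>, so no solution is lost. For \<open>\<Delta> \<ge> 1\<close> a set \<open>S\<close> of size \<open>j\<close> has at most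
  \<open>\<Delta>(k - j)(k + 1)\<close> children, which is at most \<open>(\<Delta>k)\<^sup>2\<close> unless \<open>j = 0\<close>; and a set of size \<open>j\<close> only needs
  the listed sets of size at most \<open>k - j\<close>, so that the total work stays within
  \<open>\<Sum>j. (\<Delta>k)\<^bsup>2j\<^esup> (\<Delta>k)\<^bsup>k - j\<^esup>\<close> up to polynomial factors.
\<close>

section \<open>Breadth-first enumeration\<close>

text \<open>Lists instead of sets: a set reached through several insertion orders occurs several
  times, since the machine does not look for repetitions and the length is what its running time
  pays for.\<close>

primrec level :: "('a \<Rightarrow> 'a list) \<Rightarrow> 'a \<Rightarrow> nat \<Rightarrow> 'a list" where
  "level kids x 0 = [x]"
| "level kids x (Suc i) = concat (map kids (level kids x i))"

definition levels :: "('a \<Rightarrow> 'a list) \<Rightarrow> 'a \<Rightarrow> nat \<Rightarrow> 'a list" where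
  "levels kids x m = concat (map (level kids x) [0..<Suc m])"

lemma set_levels: "set (levels kids x m) = (\<Union>i\<le>m. set (level kids x i))"
  by (auto simp: levels_def simp flip: less_Suc_eq_le simp del: upt_Suc)

lemma levels_split:
  assumes "m \<le> l"
  shows "levels kids x l = levels kids x m @ concat (map (level kids x) [Suc m..<Suc l])"
proof -
  have "[0..<Suc l] = [0..<Suc m] @ [Suc m..<Suc l]"
    using upt_add_eq_append[of 0 "Suc m" "l - m"] assms by simp
  then show ?thesis
    by (simp only: levels_def map_append concat_append)
qed

text \<open>Expanding the levels below \<open>l\<close> yields the levels 1 to \<open>l\<close>; the
  empty level \<open>Suc m\<close> closes this into a fixed-point equation, the form in which the
  queue lemmas use it.\<close>

lemma levels_unfold:
  assumes "level kids x (Suc m) = []"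
  shows "levels kids x m = x # concat (map kids (levels kids x m))"
proof -
  have "concat (map kids (concat (map (level kids x) [0..<l]))) =
      concat (map (level kids x) [1..<Suc l])" for l
    by (induction l) auto
  then have "concat (map kids (levels kids x m)) = concat (map (level kids x) [1..<Suc (Suc m)])"
    by (simp only: levels_def)
  also have "\<dots> = concat (map (level kids x) [1..<Suc m])"
    using assms by simp
  finally show ?thesis
    by (simp add: levels_def upt_conv_Cons del: upt_Suc)
qed

text \<open>The stored list after the first \<open>r\<close> entries of the final list
  \<open>xs\<close> have been expanded; it serves as loop invariant of both searches.\<close>

definition queue :: "('a \<Rightarrow> 'a list) \<Rightarrow> 'a \<Rightarrow> 'a list \<Rightarrow> nat \<Rightarrow> 'a list" where
  "queue kids x xs r = x # concat (map kids (take r xs))"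

lemma queue_0: "queue kids x xs 0 = [x]"
  by (simp add: queue_def)

lemma queue_Suc: "r < length xs \<Longrightarrow> queue kids x xs (Suc r) = queue kids x xs r @ kids (xs ! r)"
  by (simp add: queue_def take_Suc_conv_app_nth)

lemma queue_length:
  assumes "xs = x # concat (map kids xs)"
  shows "queue kids x xs (length xs) = xs"
  by (simp add: queue_def flip: assms)

lemma queue_prefix:
  assumes "xs = x # concat (map kids xs)"
  shows "queue kids x xs r @ concat (map kids (drop r xs)) = xs"
proof -
  have "queue kids x xs r @ concat (map kids (drop r xs)) = x # concat (map kids (take r xs @ drop r xs))"
    by (simp only: queue_def append_Cons map_append concat_append)
  then show ?thesis
    by (simp only: append_take_drop_id flip: assms)
qed

text \<open>If the queue were exhausted early, an element of least rank among the remaining ones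
  would have its parent among them, too.\<close>

lemma queue_nonempty:
  fixes rank :: "'a \<Rightarrow> nat"
  assumes xs: "xs = x # concat (map kids xs)"
    and rank: "\<And>y z. y \<in> set xs \<Longrightarrow> z \<in> set (kids y) \<Longrightarrow> rank y < rank z"
    and "r < length xs"
  shows "r < length (queue kids x xs r)"
  using \<open>r < length xs\<close>
proof (induction r)
  case 0
  then show ?case by (simp add: queue_def)
next
  case (Suc r)
  then have "Suc r \<le> length (queue kids x xs (Suc r))"
    by (simp add: queue_Suc)
  moreover have "Suc r \<noteq> length (queue kids x xs (Suc r))"
  proof
    let ?ys = "drop (Suc r) xs"
    assume "Suc r = length (queue kids x xs (Suc r))"
    with queue_prefix[OF xs, of "Suc r"] have ys: "?ys = concat (map kids ?ys)"
      by (metis append_eq_conv_conj)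
    have "?ys \<noteq> []"
      using Suc.prems by simp
    then obtain z where z: "z \<in> set ?ys" "\<And>y. y \<in> set ?ys \<Longrightarrow> rank z \<le> rank y"
      using ex_min_if_finite[of "rank ` set ?ys"] by (metis (no_types, opaque_lifting)
          arg_min_if_finite(1,2) finite_set linorder_not_less set_empty)
    from z(1) have "z \<in> set (concat (map kids ?ys))"
      by (subst (asm) ys)
    then obtain y where "y \<in> set ?ys" "z \<in> set (kids y)"
      by auto
    with rank[of y z] z(2)[of y] show False
      by (metis in_set_dropD linorder_not_less)
  qed
  ultimately show ?case by simp
qed

text \<open>The queue is a prefix of the final list, so an entry that is already present is the
  final one.\<close>

lemma queue_nth:
  assumes "xs = x # concat (map kids xs)" "r < length (queue kids x xs r)"
  shows "queue kids x xs r ! r = xs ! r"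
  using nth_append_left[OF assms(2), of "concat (map kids (drop r xs))"]
  by (simp only: queue_prefix[OF assms(1)])

lemma sum_list_levels:
  "sum_list (map f (levels kids x m)) = (\<Sum>i\<le>m. sum_list (map f (level kids x i)))"
  by (induction m) (simp_all add: levels_def flip: add.assoc)

section \<open>The branching rule and the exchange argument\<close>

definition touches :: "nat set set \<Rightarrow> nat set \<Rightarrow> nat set \<Rightarrow> bool" where
  "touches E X Y \<longleftrightarrow> (\<exists>u\<in>X. \<exists>v\<in>Y. u = v \<or> {u, v} \<in> E)"

lemma touches_sym: "touches E X Y \<longleftrightarrow> touches E Y X"
  unfolding touches_def by (metis insert_commute)

lemma touches_mono: "touches E X Y \<Longrightarrow> X \<subseteq> X' \<Longrightarrow> Y \<subseteq> Y' \<Longrightarrow> touches E X' Y'"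
  unfolding touches_def by blast

lemma touches_Un: "touches E (X \<union> Y) Z \<longleftrightarrow> touches E X Z \<or> touches E Y Z"
  unfolding touches_def by blast

text \<open>Being at least as good in the direction of the goal; with it the exchange argument
  treats both goals at once.\<close>

definition at_least :: "goal \<Rightarrow> real \<Rightarrow> real \<Rightarrow> bool" where
  "at_least g x y \<longleftrightarrow> (case g of Maximize \<Rightarrow> y \<le> x | Minimize \<Rightarrow> x \<le> y)"

lemma reaches_iff: "reaches g x p \<longleftrightarrow> at_least g x (of_int p)"
  by (cases g) (auto simp: at_least_def)

lemma at_least_refl [simp]: "at_least g x x"
  by (cases g) (auto simp: at_least_def)

lemma at_least_trans: "at_least g x y \<Longrightarrow> at_least g y z \<Longrightarrow> at_least g x z"
  by (cases g) (auto simp: at_least_def)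

lemma at_least_linear: "at_least g x y \<or> at_least g y x"
  by (cases g) (auto simp: at_least_def)

lemma at_least_double: "at_least g (2 * x) (2 * y) \<longleftrightarrow> at_least g x y"
  by (cases g) (auto simp: at_least_def)

lemma at_least_add_left: "at_least g (x + y) (x + z) \<longleftrightarrow> at_least g y z"
  by (cases g) (auto simp: at_least_def)

section \<open>Neighbourhoods, degrees and the doubled value\<close>

locale lgp =
  fixes n :: nat and E :: "nat set set" and k :: nat
    and g :: goal and \<alpha>1 \<alpha>2 :: real
  assumes graph: "simple_graph {..<n} E"
begin

definition adj :: "nat \<Rightarrow> nat \<Rightarrow> bool" where
  "adj u v \<longleftrightarrow> {u, v} \<in> E"

abbreviation \<Delta> :: nat where
  "\<Delta> \<equiv> max_degree {..<n} E"

definition nbhd :: "nat set \<Rightarrow> nat set" where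
  "nbhd X = {u. u < n \<and> (\<exists>v\<in>X. adj u v)}"

text \<open>Twice the value of \<open>X\<close>: inner edges are counted from both ends, and the machine cannot halve.\<close>

definition dval :: "nat set \<Rightarrow> real" where
  "dval X = (\<Sum>u\<in>X. \<Sum>v | v < n \<and> adj u v. if v \<in> X then \<alpha>1 else 2 * \<alpha>2)"

lemma adj_sym: "adj u v \<longleftrightarrow> adj v u"
  by (simp add: adj_def insert_commute)

lemma adjD: "adj u v \<Longrightarrow> u < n \<and> v < n \<and> u \<noteq> v"
  using graph by (auto simp: adj_def simple_graph_def)

lemma edgeD: "e \<in> E \<Longrightarrow> e \<subseteq> {..<n} \<and> finite e \<and> card e = 2"
  using graph finite_subset[of e "{..<n}"] by (auto simp: simple_graph_def)

lemma finite_E: "finite E"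
  using edgeD finite_subset[of E "Pow {..<n}"] by auto

text \<open>The neighbour \<open>v\<close> corresponds to the edge \<open>{u, v}\<close>. The
  predicate \<open>P\<close> serves to separate neighbours inside a set from those outside.\<close>

lemma card_nbrs: "card {v. v < n \<and> adj u v \<and> P v} = card {e \<in> E. u \<in> e \<and> (\<exists>v. e = {u, v} \<and> P v)}"
proof (rule bij_betw_same_card)
  show "bij_betw (\<lambda>v. {u, v}) {v. v < n \<and> adj u v \<and> P v}
      {e \<in> E. u \<in> e \<and> (\<exists>v. e = {u, v} \<and> P v)}"
    unfolding bij_betw_def
    by (auto simp: inj_on_def adj_def doubleton_eq_iff dest: adjD[unfolded adj_def])
qed

lemma ex_other: "e \<in> E \<Longrightarrow> u \<in> e \<Longrightarrow> \<exists>v. e = {u, v} \<and> u \<noteq> v"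
  using edgeD[of e] by (auto simp: card_2_iff)

lemma card_nbrs_le: "card {v. v < n \<and> adj u v} \<le> \<Delta>"
proof (cases "u < n")
  case True
  have "card {v. v < n \<and> adj u v} \<le> degree_of E u"
    using card_nbrs[of u "\<lambda>_. True"] finite_E
    by (auto simp: degree_of_def intro!: card_mono)
  also have "\<dots> \<le> \<Delta>"
    using True by (auto simp: max_degree_def intro!: Max_ge)
  finally show ?thesis .
next
  case False
  then have "{v. v < n \<and> adj u v} = {}" by (auto dest: adjD)
  then show ?thesis by (simp only: card.empty)
qed

lemma card_nbhd_le:
  assumes "finite X"
  shows "card (nbhd X) \<le> card X * \<Delta>"
proof -
  have "nbhd X = (\<Union>v\<in>X. {u. u < n \<and> adj v u})"
    by (auto simp: nbhd_def adj_sym)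
  then have "card (nbhd X) \<le> (\<Sum>v\<in>X. card {u. u < n \<and> adj v u})"
    using card_UN_le[OF assms] by simp
  also have "\<dots> \<le> (\<Sum>v\<in>X. \<Delta>)"
    by (intro sum_mono card_nbrs_le)
  finally show ?thesis by simp
qed

lemma double_count:
  assumes "finite X" "finite A"
  shows "(\<Sum>u\<in>X. card {e \<in> A. u \<in> e}) = (\<Sum>e\<in>A. card (e \<inter> X))"
proof -
  have "(\<Sum>u\<in>X. card {e \<in> A. u \<in> e}) = (\<Sum>u\<in>X. \<Sum>e\<in>A. of_bool (u \<in> e))"
    using assms by (intro sum.cong) (auto simp: of_bool_def sum.If_cases Int_def)
  also have "\<dots> = (\<Sum>e\<in>A. \<Sum>u\<in>X. of_bool (u \<in> e))"
    by (rule sum.swap)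
  also have "\<dots> = (\<Sum>e\<in>A. card (e \<inter> X))"
    using assms by (intro sum.cong) (auto simp: of_bool_def sum.If_cases Int_def conj_commute)
  finally show ?thesis .
qed

text \<open>Double counting of incidences: an inner edge is met from both of its ends, each time
  with weight \<open>\<alpha>1\<close>, a cut edge only from its end in \<open>X\<close>, with
  weight \<open>2 * \<alpha>2\<close>.\<close>

lemma dval_eq:
  assumes X: "X \<subseteq> {..<n}"
  shows "dval X = 2 * lgp_val \<alpha>1 \<alpha>2 E X"
proof -
  have fin: "finite X"
    using X finite_subset by blast
  have inner: "card {v. v < n \<and> adj u v \<and> v \<in> X} = card {e \<in> inner_edges E X. u \<in> e}" if "u \<in> X" for u
  proof -
    have "u \<in> e \<and> (\<exists>v. e = {u, v} \<and> v \<in> X) \<longleftrightarrow> u \<in> e \<and> e \<subseteq> X" if "e \<in> E" for e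
      using \<open>u \<in> X\<close> ex_other[OF that, of u] by auto
    then show ?thesis
      unfolding card_nbrs inner_edges_def by (intro arg_cong[of _ _ card]) auto
  qed
  have cut: "card {v. v < n \<and> adj u v \<and> v \<notin> X} = card {e \<in> cut_edges E X. u \<in> e}" if "u \<in> X" for u
  proof -
    have "card ({u, v} \<inter> X) = 1 \<longleftrightarrow> v \<notin> X" if "u \<noteq> v" for v
      using that \<open>u \<in> X\<close> by (cases "v \<in> X") auto
    then have "u \<in> e \<and> (\<exists>v. e = {u, v} \<and> v \<notin> X) \<longleftrightarrow> u \<in> e \<and> card (e \<inter> X) = 1" if "e \<in> E" for e
      using \<open>u \<in> X\<close> ex_other[OF that, of u] by (metis doubleton_eq_iff)
    then show ?thesis
      unfolding card_nbrs cut_edges_def by (intro arg_cong[of _ _ card]) auto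
  qed
  have "dval X = (\<Sum>u\<in>X. \<alpha>1 * card {v. v < n \<and> adj u v \<and> v \<in> X}
      + 2 * \<alpha>2 * card {v. v < n \<and> adj u v \<and> v \<notin> X})"
    unfolding dval_def
    by (intro sum.cong refl) (simp add: sum.If_cases Int_def conj_ac Collect_conj_eq[symmetric])
  also have "\<dots> = \<alpha>1 * real (\<Sum>u\<in>X. card {e \<in> inner_edges E X. u \<in> e})
      + 2 * \<alpha>2 * real (\<Sum>u\<in>X. card {e \<in> cut_edges E X. u \<in> e})"
    using inner cut by (simp add: sum.distrib sum_distrib_left)
  also have "(\<Sum>u\<in>X. card {e \<in> inner_edges E X. u \<in> e}) = 2 * card (inner_edges E X)"
    by (subst double_count) (auto simp: fin finite_E inner_edges_def Int_absorb2 edgeD)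
  also have "(\<Sum>u\<in>X. card {e \<in> cut_edges E X. u \<in> e}) = card (cut_edges E X)"
    by (subst double_count) (auto simp: fin finite_E cut_edges_def)
  finally show ?thesis
    by (simp add: lgp_val_def)
qed

text \<open>No edge joins \<open>X\<close> and \<open>Y\<close>, so for neighbours of a vertex in
  one part, membership in \<open>X \<union> Y\<close> agrees with membership in that part.\<close>

lemma dval_Un:
  assumes "finite X" "finite Y" "\<not> touches E X Y"
  shows "dval (X \<union> Y) = dval X + dval Y"
proof -
  have XY: "X \<inter> Y = {}" "\<And>u v. u \<in> X \<Longrightarrow> v \<in> Y \<Longrightarrow> \<not> adj u v \<and> \<not> adj v u"
    using assms(3) by (auto simp: touches_def adj_def insert_commute)
  have "dval (X \<union> Y) = (\<Sum>u\<in>X. \<Sum>v | v < n \<and> adj u v. if v \<in> X \<union> Y then \<alpha>1 else 2 * \<alpha>2)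
      + (\<Sum>u\<in>Y. \<Sum>v | v < n \<and> adj u v. if v \<in> X \<union> Y then \<alpha>1 else 2 * \<alpha>2)"
    unfolding dval_def by (rule sum.union_disjoint[OF assms(1,2) XY(1)])
  also have "\<dots> = dval X + dval Y"
    unfolding dval_def
    by (intro arg_cong2[of _ _ _ _ "(+)"] sum.cong refl) (use XY(2) in auto)
  finally show ?thesis .
qed

section \<open>The two search trees\<close>

definition extensions :: "bool \<Rightarrow> nat set \<Rightarrow> nat set \<Rightarrow> nat set list" where
  "extensions b S B = map (\<lambda>u. insert u S) (filter (\<lambda>u. u \<notin> S \<and> (b \<or> u \<in> B \<or> u \<in> nbhd (S \<union> B))) [0..<n])"

text \<open>With \<open>B = {}\<close> only outside neighbours of \<open>S\<close> qualify. The
  empty set has none, so the flag \<open>S = {}\<close> admits all singletons there.\<close>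

definition conn_kids :: "nat set \<Rightarrow> nat set list" where
  "conn_kids S = (if card S < k then extensions (S = {}) S {} else [])"

abbreviation conn_upto :: "nat \<Rightarrow> nat set list" where
  "conn_upto \<equiv> levels conn_kids {}"

text \<open>One step of a linear search: \<open>B\<close> is the best candidate so far, with
  \<open>{}\<close> for none, and a tie goes to the newcomer. The machine performs exactly this
  update per scanned set.\<close>

definition pick :: "nat set \<Rightarrow> nat \<Rightarrow> nat set \<Rightarrow> nat set \<Rightarrow> nat set" where
  "pick S i D B = (if card D = i \<and> \<not> touches E D S \<and> (B = {} \<or> at_least g (dval D) (dval B)) then D else B)"

text \<open>Only listed sets of size at most \<open>k - card S\<close> are scanned, which keeps the
  search cheap for large \<open>S\<close>. Without a candidate the value is \<open>{}\<close>; then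
  \<open>extensions\<close> still offers the neighbours of \<open>S\<close>.\<close>

definition best :: "nat set \<Rightarrow> nat \<Rightarrow> nat set" where
  "best S i = fold (pick S i) (conn_upto (k - card S)) {}"

definition sol_kids :: "nat set \<Rightarrow> nat set list" where
  "sol_kids S = (if card S < k
     then concat (map (\<lambda>i. extensions False S (best S i)) [1..<Suc (k - card S)]) else [])"

lemma set_extensions:
  "set (extensions b S B) = {insert u S | u. u < n \<and> u \<notin> S \<and> (b \<or> u \<in> B \<or> u \<in> nbhd (S \<union> B))}"
  by (auto simp: extensions_def)

lemma card_extension:
  assumes "S \<subseteq> {..<n}" "X \<in> set (extensions b S B)"
  shows "X \<subseteq> {..<n} \<and> card X = Suc (card S)"
  using assms finite_subset[of S "{..<n}"] by (auto simp: set_extensions)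

lemma level_card:
  assumes "\<And>S X. S \<subseteq> {..<n} \<Longrightarrow> X \<in> set (kids S) \<Longrightarrow> X \<subseteq> {..<n} \<and> card X = Suc (card S)"
  shows "X \<in> set (level kids {} i) \<Longrightarrow> X \<subseteq> {..<n} \<and> card X = i"
proof (induction i arbitrary: X)
  case (Suc i)
  then obtain S where S: "S \<in> set (level kids {} i)" "X \<in> set (kids S)"
    by auto
  from Suc.IH[OF S(1)] have "S \<subseteq> {..<n}" "card S = i"
    by auto
  with assms[OF _ S(2)] show ?case
    by simp
qed simp

lemma conn_kid: "S \<subseteq> {..<n} \<Longrightarrow> X \<in> set (conn_kids S) \<Longrightarrow> X \<subseteq> {..<n} \<and> card X = Suc (card S)"
  by (rule card_extension[where B = "{}" and b = "S = {}"]) (simp_all add: conn_kids_def split: if_splits)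

lemma sol_kid: "S \<subseteq> {..<n} \<Longrightarrow> X \<in> set (sol_kids S) \<Longrightarrow> X \<subseteq> {..<n} \<and> card X = Suc (card S)"
  by (auto simp: sol_kids_def simp del: upt_Suc split: if_splits dest: card_extension)

lemma conn_level: "X \<in> set (level conn_kids {} i) \<Longrightarrow> X \<subseteq> {..<n} \<and> card X = i"
  by (rule level_card[OF conn_kid])

lemma sol_level: "X \<in> set (level sol_kids {} i) \<Longrightarrow> X \<subseteq> {..<n} \<and> card X = i"
  by (rule level_card[OF sol_kid])

text \<open>Sets of size \<open>k\<close> are not expanded; this is the hypothesis under which
  \<open>levels_unfold\<close> applies.\<close>

lemma conn_level_Suc_k: "level conn_kids {} (Suc k) = []"
  by (simp add: conn_kids_def conn_level)

lemma sol_level_Suc_k: "level sol_kids {} (Suc k) = []"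
  by (simp add: sol_kids_def sol_level)

lemma conn_uptoD: "D \<in> set (conn_upto m) \<Longrightarrow> D \<subseteq> {..<n} \<and> card D \<le> m \<and> D \<in> set (level conn_kids {} (card D))"
  unfolding set_levels by (auto dest: conn_level)

lemma conn_singleton: "v < n \<Longrightarrow> 0 < m \<Longrightarrow> 0 < k \<Longrightarrow> {v} \<in> set (conn_upto m)"
  unfolding set_levels
  by (rule UN_I[of 1]) (auto simp: conn_kids_def set_extensions)

lemma conn_insert:
  assumes "D \<in> set (conn_upto m)" "card D < m" "m \<le> k" "u \<in> nbhd D" "u \<notin> D"
  shows "insert u D \<in> set (conn_upto m)"
proof -
  have "insert u D \<in> set (conn_kids D)"
    using assms by (auto simp: conn_kids_def set_extensions nbhd_def)
  then have "insert u D \<in> set (level conn_kids {} (Suc (card D)))"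
    using conn_uptoD[OF assms(1)] by auto
  then show ?thesis
    using assms(2) unfolding set_levels by (intro UN_I[of "Suc (card D)"]) auto
qed

section \<open>Best candidates and the exchange argument\<close>

lemma fold_pick:
  fixes S D :: "nat set" and Ds :: "nat set list"
  assumes "0 < i"
  defines "ok \<equiv> \<lambda>D. card D = i \<and> \<not> touches E D S"
  shows "fold (pick S i) Ds {} = {} \<or> fold (pick S i) Ds {} \<in> set Ds \<and> ok (fold (pick S i) Ds {})"
    and "D \<in> set Ds \<Longrightarrow> ok D \<Longrightarrow>
      fold (pick S i) Ds {} \<noteq> {} \<and> at_least g (dval (fold (pick S i) Ds {})) (dval D)"
\<comment> \<open>\<open>fold\<close> runs from the left, so the induction appends the newest
  candidate \<open>X\<close> at the end. As \<open>0 < i\<close>, candidates are nonempty and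
  \<open>{}\<close> unambiguously means that none was found.\<close>
proof (induction Ds arbitrary: D rule: rev_induct)
  case (snoc X Ds)
  {
    case 1
    then show ?case using snoc(1) by (auto simp: pick_def ok_def)
  next
    case (2 D)
    let ?B = "fold (pick S i) Ds {}" and ?B' = "fold (pick S i) (Ds @ [X]) {}"
    have B': "?B' = (if ok X \<and> (?B = {} \<or> at_least g (dval X) (dval ?B)) then X else ?B)"
      by (simp add: pick_def ok_def)
    have X: "X \<noteq> {}" if "ok X"
      using that \<open>0 < i\<close> by (auto simp: ok_def)
    show ?case
    proof (cases "D \<in> set Ds")
      case True
      with snoc(2)[OF this 2(2)] X show ?thesis
        unfolding B' using at_least_trans by auto
    next
      case False
      with 2 have "D = X" by simp
      with X 2(2) at_least_linear[of g "dval X" "dval ?B"] show ?thesis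
        unfolding B' by auto
    qed
  }
qed simp_all

lemma best_cases:
  "0 < i \<Longrightarrow> best S i = {} \<or> best S i \<in> set (conn_upto (k - card S)) \<and> card (best S i) = i \<and> \<not> touches E (best S i) S"
  unfolding best_def by (rule fold_pick(1))

lemma best_optimal:
  assumes "0 < card D" "D \<in> set (conn_upto (k - card S))" "\<not> touches E D S"
  shows "best S (card D) \<noteq> {} \<and> at_least g (dval (best S (card D))) (dval D)"
  unfolding best_def by (rule fold_pick(2)) (use assms in auto)

text \<open>A listed nonempty subset of \<open>R\<close> of greatest cardinality is separated from
  the rest: a neighbour in \<open>R - C\<close> could be inserted by \<open>conn_insert\<close>,
  giving a larger one. Connectedness is thus never defined; being listed takes its place.\<close>

lemma ex_closed_conn:
  assumes R: "R \<subseteq> {..<n}" "R \<noteq> {}" "card R \<le> k"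
  obtains C where "C \<in> set (conn_upto (card R))" "C \<noteq> {}" "C \<subseteq> R" "\<not> touches E C (R - C)"
proof -
  have fin: "finite R"
    using R(1) finite_subset by blast
  let ?P = "\<lambda>C. C \<in> set (conn_upto (card R)) \<and> C \<noteq> {} \<and> C \<subseteq> R"
  obtain v where "v \<in> R" using R(2) by blast
  moreover have "0 < card R" using fin R(2) by (simp add: card_gt_0_iff)
  ultimately have "?P {v}" using R conn_singleton[of v "card R"] by auto
  moreover have "\<forall>C. ?P C \<longrightarrow> card C < Suc (card R)"
    using card_mono[OF fin] by (auto simp: less_Suc_eq_le)
  ultimately obtain C where C: "?P C" "\<And>C'. ?P C' \<Longrightarrow> card C' \<le> card C"
    using ex_has_greatest_nat[of ?P "{v}" card "Suc (card R)"] by blast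
  have "\<not> touches E C (R - C)"
  proof
    assume "touches E C (R - C)"
    then obtain u where u: "u \<in> R - C" "u \<in> nbhd C"
      using R(1) by (force simp: touches_def nbhd_def adj_def insert_commute)
    then have "C \<subset> R" using C(1) by blast
    then have "card C < card R" by (rule psubset_card_mono[OF fin])
    with u C(1) R(3) have "?P (insert u C)" using conn_insert by blast
    from C(2)[OF this] u C(1) fin show False by (auto simp: finite_subset)
  qed
  with C(1) that show ?thesis by blast
qed

definition solution :: "int \<Rightarrow> nat set \<Rightarrow> bool" where
  "solution p T \<longleftrightarrow> T \<subseteq> {..<n} \<and> card T = k \<and> at_least g (dval T) (2 * of_int p)"

text \<open>Exchange argument: if \<open>S\<close> is separated from the rest of the solution \<open>T\<close>, then a connected
  piece \<open>C\<close> of the rest can be traded for the best separated piece \<open>B\<close> of the same size, unless \<open>T\<close>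
  contains a vertex in or next to \<open>B\<close>.\<close>

lemma solution_step:
  assumes T: "solution p T" and S: "S \<subseteq> T" "card S < k"
  obtains X T' where "X \<in> set (sol_kids S)" "solution p T'" "X \<subseteq> T'"
proof -
  have fin: "finite T" and Tn: "T \<subseteq> {..<n}" and card: "card T = k"
    using T finite_subset by (auto simp: solution_def)
  have kid: "insert u S \<in> set (sol_kids S)"
    if "u < n" "u \<notin> S" "0 < i" "i \<le> k - card S" "u \<in> best S i \<or> u \<in> nbhd (S \<union> best S i)" for u i
    using that S(2) unfolding sol_kids_def
    by (auto simp: set_extensions intro!: bexI[of _ i])
  define R where "R = T - S"
  have cardR: "card R = k - card S"
    using S(1) fin card by (simp add: R_def card_Diff_subset finite_subset)
  show ?thesis
  proof (cases "\<exists>u \<in> R. u \<in> nbhd S")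
    case True
    then obtain u where "u \<in> R" "u \<in> nbhd S" by blast
    \<comment> \<open>Neighbours of \<open>S\<close> qualify for every \<open>i\<close>;
      \<open>i = 1\<close> is available because \<open>card S < k\<close>.\<close>
    then have "insert u S \<in> set (sol_kids S)"
      using kid[of u 1] S(2) by (auto simp only: R_def nbhd_def Suc_le_eq One_nat_def zero_less_diff)
    moreover have "insert u S \<subseteq> T" using \<open>u \<in> R\<close> S(1) by (auto simp: R_def)
    ultimately show ?thesis using that T by blast
  next
    case False
    then have SR: "\<not> touches E R S"
      using Tn by (auto simp: touches_def R_def nbhd_def adj_def)
    have "R \<noteq> {}" using cardR S(2) by auto
    moreover have "R \<subseteq> {..<n}" "card R \<le> k" using cardR Tn by (auto simp: R_def)
    ultimately obtain C where C: "C \<in> set (conn_upto (card R))" "C \<noteq> {}" "C \<subseteq> R" "\<not> touches E C (R - C)"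
      using ex_closed_conn by metis
    have finR: "finite R" and finC: "finite C" and finS: "finite S"
      using fin C(3) S(1) by (auto simp: R_def finite_subset)
    define i where "i = card C"
    have i: "0 < i" "i \<le> k - card S"
      using C(2,3) finC finR cardR card_mono[of R C] by (auto simp: i_def card_gt_0_iff)
    define B where "B = best S i"
    have "\<not> touches E C S" using SR C(3) touches_mono by blast
    then have "B \<noteq> {}" and BC: "at_least g (dval B) (dval C)"
      using best_optimal[of C S] C(1) i(1) cardR by (auto simp: B_def i_def)
    then have B: "B \<subseteq> {..<n}" "card B = i" "\<not> touches E B S"
      using best_cases[of i S] i(1) conn_uptoD by (auto simp: B_def)
    have finB: "finite B" using B(1) finite_subset by blast
    show ?thesis
    proof (cases "\<exists>u \<in> R. u \<in> B \<or> u \<in> nbhd B")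
      case True
      then obtain u where u: "u \<in> R" "u \<in> B \<or> u \<in> nbhd B" by blast
      then have "insert u S \<in> set (sol_kids S)"
        using kid[of u i] i Tn by (auto simp: R_def B_def nbhd_def)
      moreover have "insert u S \<subseteq> T" using u S(1) by (auto simp: R_def)
      ultimately show ?thesis using that T by blast
    next
      case False
      then have RB: "\<not> touches E R B"
        using \<open>R \<subseteq> {..<n}\<close> by (auto simp: touches_def nbhd_def adj_def)
      \<comment> \<open>\<open>Q\<close> is what remains of \<open>T\<close> without
        \<open>C\<close>. It touches neither \<open>C\<close> nor \<open>B\<close>, so the values of
        \<open>T = Q \<union> C\<close> and of \<open>Q \<union> B\<close> both split, and trading
        \<open>C\<close> for \<open>B\<close> loses nothing.\<close>
      define Q where "Q = S \<union> (R - C)"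
      have QB: "\<not> touches E Q B"
        using RB B(3) touches_mono[of E "R - C" B R B] touches_sym[of E S B] by (auto simp: Q_def touches_Un)
      have QC: "\<not> touches E Q C"
        using \<open>\<not> touches E C S\<close> C(4) by (simp add: Q_def touches_Un touches_sym[of E _ C])
      have T_eq: "T = Q \<union> C" using C(3) S(1) by (auto simp: Q_def R_def)
      have finQ: "finite Q" using finS finR by (simp add: Q_def)
      have disj: "Q \<inter> B = {}" "Q \<inter> C = {}" using QB QC by (auto simp: touches_def)
      have "card (Q \<union> B) = card T"
        unfolding T_eq using disj finQ finB finC B(2) by (simp add: card_Un_disjoint i_def)
      moreover have "at_least g (dval (Q \<union> B)) (dval T)"
        unfolding T_eq using BC by (simp add: dval_Un finQ finB finC QB QC at_least_add_left)
      ultimately have "solution p (Q \<union> B)"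
        using T B(1) T_eq at_least_trans by (auto simp: solution_def)
      \<comment> \<open>Any vertex of \<open>B\<close> will do: it lies in the new solution, and it
        is outside \<open>S\<close> because \<open>B\<close> does not touch
        \<open>S\<close>.\<close>
      moreover obtain u where u: "u \<in> B" using \<open>B \<noteq> {}\<close> by blast
      then have "insert u S \<in> set (sol_kids S)"
        using kid[of u i] i B by (auto simp: B_def touches_def)
      moreover have "insert u S \<subseteq> Q \<union> B" using u by (auto simp: Q_def)
      ultimately show ?thesis using that by blast
    qed
  qed
qed

text \<open>The solution containing the partial set may change from one level to the next, hence the
  inner quantifier over \<open>T'\<close>.\<close>

lemma solution_level:
  assumes "solution p T" "j \<le> k"
  shows "\<exists>S \<in> set (level sol_kids {} j). \<exists>T'. solution p T' \<and> S \<subseteq> T'"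
  using assms(2)
proof (induction j)
  case 0
  then show ?case using assms(1) by auto
next
  case (Suc j)
  then obtain S T' where S: "S \<in> set (level sol_kids {} j)" "solution p T'" "S \<subseteq> T'"
    by auto
  with sol_level[OF S(1)] Suc.prems obtain X T'' where "X \<in> set (sol_kids S)" "solution p T''" "X \<subseteq> T''"
    using solution_step[of p T' S] by auto
  with S(1) show ?case by auto
qed

text \<open>At level \<open>k\<close> the partial set has the same size as the solution containing
  it, hence equals it.\<close>

lemma solution_iff:
  "(\<exists>T. solution p T) \<longleftrightarrow>
     (\<exists>S \<in> set (levels sol_kids {} k). card S = k \<and> at_least g (dval S) (2 * of_int p))"
proof
  assume "\<exists>T. solution p T"
  then obtain S T' where S: "S \<in> set (level sol_kids {} k)" "solution p T'" "S \<subseteq> T'"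
    using solution_level by blast
  have "finite T'" "card S = card T'"
    using S(2) sol_level[OF S(1)] finite_subset by (auto simp: solution_def)
  then have "S = T'" using S(3) card_subset_eq by blast
  then show "\<exists>S \<in> set (levels sol_kids {} k). card S = k \<and> at_least g (dval S) (2 * of_int p)"
    using S by (auto simp: set_levels solution_def)
next
  assume "\<exists>S \<in> set (levels sol_kids {} k). card S = k \<and> at_least g (dval S) (2 * of_int p)"
  then show "\<exists>T. solution p T"
    using sol_level by (auto simp: set_levels solution_def)
qed

lemma solution_yes:
  assumes "num_verts I = n" "edges I = E" "sol_size I = int k"
  shows "lgp_yes g \<alpha>1 \<alpha>2 I \<longleftrightarrow> (\<exists>T. solution (threshold I) T)"
proof -
  have "reaches g (lgp_val \<alpha>1 \<alpha>2 E T) p \<longleftrightarrow> at_least g (dval T) (2 * of_int p)" if "T \<subseteq> {..<n}" for T p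
    using at_least_double[of g "lgp_val \<alpha>1 \<alpha>2 E T" "of_int p"] dval_eq[OF that] by (simp add: reaches_iff)
  then show ?thesis
    unfolding lgp_yes_def solution_def assms by (auto simp: assms)
qed


section \<open>Size of the enumeration\<close>

text \<open>The maximum keeps powers of \<open>M\<close> monotone in the exponent for graphs without
  edges, and matches the maximum in \<open>solvable_in_O_star\<close>.\<close>

definition M :: nat where
  "M = max 1 (\<Delta> * k)"

lemma M_ge_1: "1 \<le> M"
  by (simp add: M_def)

lemma length_extensions_le:
  assumes "finite S" "finite B"
  shows "length (extensions False S B) \<le> card B + (card S + card B) * \<Delta>"
proof -
  have "length (extensions False S B) = card {u \<in> {..<n}. u \<notin> S \<and> (u \<in> B \<or> u \<in> nbhd (S \<union> B))}"
    by (simp add: extensions_def distinct_length_filter Int_def atLeast0LessThan conj_commute)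
  also have "\<dots> \<le> card (B \<union> nbhd (S \<union> B))"
    using assms by (intro card_mono) (auto simp: nbhd_def)
  also have "\<dots> \<le> card B + card (nbhd (S \<union> B))"
    by (rule card_Un_le)
  also have "card (nbhd (S \<union> B)) \<le> card (S \<union> B) * \<Delta>"
    using assms by (intro card_nbhd_le) simp
  also have "card (S \<union> B) * \<Delta> \<le> (card S + card B) * \<Delta>"
    by (intro mult_right_mono card_Un_le) simp
  finally show ?thesis by simp
qed

lemma length_concat_map_le:
  assumes "\<And>x. x \<in> set xs \<Longrightarrow> length (f x) \<le> c"
  shows "length (concat (map f xs)) \<le> length xs * c"
  using assms by (induction xs) (auto intro: add_mono)

text \<open>There are at most \<open>n\<close> singletons, and a nonempty listed set has at most
  \<open>card S * \<Delta>\<close> extensions. The base is \<open>\<Delta> * k\<close> and not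
  \<open>M\<close>, so that in graphs without edges the bound vanishes from size 2 on.\<close>

lemma length_conn_level: "length (level conn_kids {} (Suc i)) \<le> n * (\<Delta> * k) ^ i"
proof (induction i)
  case 0
  show ?case
    by (simp add: conn_kids_def extensions_def)
next
  case (Suc i)
  have "length (conn_kids S) \<le> \<Delta> * k" if "S \<in> set (level conn_kids {} (Suc i))" for S
  proof -
    have S: "finite S" "card S = Suc i"
      using conn_level[OF that] finite_subset by auto
    then have "S \<noteq> {}" by auto
    with S length_extensions_le[of S "{}"] show ?thesis
      using mult_le_mono1[of "card S" k \<Delta>] by (auto simp: conn_kids_def mult.commute)
  qed
  then have "length (level conn_kids {} (Suc (Suc i))) \<le> length (level conn_kids {} (Suc i)) * (\<Delta> * k)"
    unfolding level.simps(2)[of _ _ "Suc i"] by (rule length_concat_map_le)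
  also have "\<dots> \<le> n * (\<Delta> * k) ^ i * (\<Delta> * k)"
    using Suc by (rule mult_right_mono) simp
  finally show ?case by (simp add: mult_ac)
qed

lemma length_conn_upto: "length (conn_upto m) \<le> Suc n * Suc m * M ^ m"
proof -
  \<comment> \<open>\<open>Suc n\<close> instead of \<open>n\<close> covers the single entry of
    level 0 even for \<open>n = 0\<close>.\<close>
  have "length (level conn_kids {} i) \<le> Suc n * M ^ m" if "i \<le> m" for i
  proof (cases i)
    case 0
    then show ?thesis using one_le_power[OF M_ge_1, of m] by (simp add: trans_le_add1)
  next
    case (Suc l)
    have "(\<Delta> * k) ^ l \<le> M ^ l" by (rule power_mono) (auto simp: M_def)
    also have "\<dots> \<le> M ^ m" using that Suc M_ge_1 by (intro power_increasing) auto
    finally have "n * (\<Delta> * k) ^ l \<le> Suc n * M ^ m" by (intro mult_mono) auto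
    then show ?thesis using length_conn_level[of l] Suc by simp
  qed
  then have "(\<Sum>i\<le>m. length (level conn_kids {} i)) \<le> (\<Sum>i\<le>m. Suc n * M ^ m)"
    by (intro sum_mono) auto
  then show ?thesis
    using sum_list_levels[of "\<lambda>_. 1 :: nat" conn_kids "{}" m] by (simp add: sum_list_triv algebra_simps)
qed

lemma best_finite: "0 < i \<Longrightarrow> finite (best S i) \<and> card (best S i) \<le> i"
  using best_cases[of i S] conn_uptoD[of "best S i"] finite_subset[of "best S i" "{..<n}"] by auto

text \<open>Without edges only singletons are listed, so that the case \<open>i = 1\<close> alone contributes a child; with
  edges, the sum over \<open>i\<close> of \<open>\<Delta>(j + 2i)\<close> is \<open>\<Delta>(k - j)(k + 1)\<close>.\<close>

lemma length_sol_kids: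
  assumes S: "finite S"
  shows "length (sol_kids S) \<le> (if S = {} then 2 else 1) * M\<^sup>2"
proof (cases "card S < k")
  case True
  define j where "j = card S"
  obtain d where k: "k = j + Suc d"
    using True less_imp_Suc_add by (auto simp: j_def)
  have len: "length (sol_kids S) = (\<Sum>i = 1..Suc d. length (extensions False S (best S i)))"
    using True k unfolding j_def sol_kids_def
    by (simp add: length_concat comp_def interv_sum_list_conv_sum_set_nat atLeastLessThanSuc_atLeastAtMost
        del: upt_Suc)
  have ext: "length (extensions False S (best S i)) \<le> card (best S i) + (j + card (best S i)) * \<Delta>"
    if "0 < i" for i
    using length_extensions_le[OF S] best_finite[OF that] by (simp add: j_def)
  show ?thesis
  proof (cases "\<Delta> = 0")
    case True
    have best: "card (best S i) \<le> of_bool (i = 1)" if "0 < i" for i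
    proof (cases "i = 1")
      case False
      with that obtain l where l: "i = Suc (Suc l)" by (metis One_nat_def gr0_implies_Suc neq0_conv)
      have "level conn_kids {} i = []"
        using length_conn_level[of "Suc l"] by (simp add: True l del: level.simps)
      then show ?thesis using best_cases[OF that, of S] conn_uptoD[of "best S i" "k - card S"] by auto
    qed (use best_finite that in auto)
    have "length (extensions False S (best S i)) \<le> of_bool (i = 1)" if "0 < i" for i
      using order_trans[OF _ best[OF that]] ext[OF that] True by simp
    then have "length (sol_kids S) \<le> (\<Sum>i = 1..Suc d. of_bool (i = 1))"
      unfolding len by (intro sum_mono) auto
    also have "\<dots> = 1" by simp
    finally show ?thesis using one_le_power[OF M_ge_1, of 2] by auto
  next
    case False
    have "length (sol_kids S) \<le> (\<Sum>i = 1..Suc d. \<Delta> * (j + 2 * i))"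
      unfolding len
    proof (intro sum_mono)
      fix i assume "i \<in> {1..Suc d}"
      then have "length (extensions False S (best S i)) \<le> card (best S i) + (j + card (best S i)) * \<Delta>"
        and le: "card (best S i) \<le> i"
        using ext[of i] best_finite[of i S] by auto
      note this(1)
      also have "card (best S i) + (j + card (best S i)) * \<Delta> \<le> i + (j + i) * \<Delta>"
        using le by (intro add_mono mult_right_mono) auto
      \<comment> \<open>Since \<open>\<Delta>\<close> is positive, the summand \<open>i\<close> is
        at most \<open>\<Delta> * i\<close>.\<close>
      also have "\<dots> \<le> \<Delta> * (j + 2 * i)"
        using False by (simp add: algebra_simps)
      finally show "length (extensions False S (best S i)) \<le> \<Delta> * (j + 2 * i)" .
    qed
    also have "\<dots> = \<Delta> * (Suc d * (j + Suc (Suc d)))"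
    proof -
      have "(\<Sum>i = 1..e. j + 2 * i) = e * (j + Suc e)" for e
        by (induction e) (auto simp: algebra_simps)
      then show ?thesis by (simp only: flip: sum_distrib_left)
    qed
    \<comment> \<open>Here \<open>Suc d = k - j\<close>, and the other factor is
      \<open>k + 1\<close>. For \<open>j \<ge> 1\<close> their product is at most
      \<open>(k - 1) * (k + 1)\<close>, below \<open>k\<^sup>2\<close>; for \<open>j = 0\<close> it
      is at most \<open>2 * k\<^sup>2\<close>.\<close>
    also have "\<dots> \<le> \<Delta> * ((if S = {} then 2 else 1) * k\<^sup>2)"
    proof (cases "S = {}")
      case True
      then show ?thesis by (simp add: k j_def power2_eq_square)
    next
      case False
      then obtain l where "j = Suc l"
        using S by (metis card_gt_0_iff gr0_implies_Suc j_def)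
      with False show ?thesis by (simp add: k power2_eq_square algebra_simps)
    qed
    also have "\<dots> \<le> (if S = {} then 2 else 1) * (\<Delta> * k)\<^sup>2"
      using False by (simp add: power2_eq_square)
    also have "\<dots> \<le> (if S = {} then 2 else 1) * M\<^sup>2"
      by (intro mult_left_mono power_mono) (auto simp: M_def)
    finally show ?thesis .
  qed
qed (simp add: sol_kids_def)

text \<open>The factor 2 arises at the root alone: every later set is nonempty and has at most
  \<open>M\<^sup>2\<close> children. Level 1 is therefore the base of the induction.\<close>

lemma length_sol_level: "length (level sol_kids {} j) \<le> 2 * M ^ (2 * j)"
proof -
  have "length (level sol_kids {} (Suc j)) \<le> 2 * M ^ (2 * Suc j)" for j
  proof (induction j)
    case 0
    show ?case using length_sol_kids[of "{}"] by (simp add: power2_eq_square)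
  next
    case (Suc j)
    have "length (sol_kids S) \<le> M\<^sup>2" if "S \<in> set (level sol_kids {} (Suc j))" for S
      using sol_level[OF that] length_sol_kids[of S] finite_subset[of S "{..<n}"] by (auto split: if_splits)
    then have "length (level sol_kids {} (Suc (Suc j))) \<le> length (level sol_kids {} (Suc j)) * M\<^sup>2"
      unfolding level.simps(2)[of _ _ "Suc j"] by (rule length_concat_map_le)
    also have "\<dots> \<le> 2 * M ^ (2 * Suc j) * M\<^sup>2"
      using Suc by (rule mult_right_mono) simp
    finally show ?case by (simp add: power2_eq_square mult_ac)
  qed
  then show ?thesis by (cases j) auto
qed

end

section \<open>Running time of programs\<close>

text \<open>Total correctness with a time bound: a terminating run is asserted, and \<open>T\<close>
  bounds its length from above.\<close>

definition runs :: "com \<Rightarrow> state \<Rightarrow> nat \<Rightarrow> (state \<Rightarrow> bool) \<Rightarrow> bool" where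
  "runs c s T Q \<longleftrightarrow> (\<exists>t s'. exec c s t s' \<and> t \<le> T \<and> Q s')"

lemma runs_mono:
  "runs c s T P \<Longrightarrow> T \<le> T' \<Longrightarrow> (\<And>s'. P s' \<Longrightarrow> Q s') \<Longrightarrow> runs c s T' Q"
  unfolding runs_def by (meson order_trans)

lemma runs_IAssign: "Q (s\<lparr>ivars := (ivars s)(x := ival a s)\<rparr>) \<Longrightarrow> 0 < T \<Longrightarrow> runs (IAssign x a) s T Q"
  unfolding runs_def using exec.IAssign by (metis Suc_leI One_nat_def)

lemma runs_Seq:
  assumes "runs c1 s T1 P" "\<And>s'. P s' \<Longrightarrow> runs c2 s' T2 Q" "T1 + T2 \<le> T"
  shows "runs (Seq c1 c2) s T Q"
  using assms unfolding runs_def by (meson add_mono exec.Seq order_trans)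

lemma runs_Cond:
  assumes "tval b s \<Longrightarrow> runs c1 s T Q" "\<not> tval b s \<Longrightarrow> runs c2 s T Q"
  shows "runs (Cond b c1 c2) s (1 + T) Q"
  using assms unfolding runs_def by (meson add_left_mono exec.CondFalse exec.CondTrue)

text \<open>The invariant is indexed by the number of iterations done, of which there are
  \<open>N\<close>. The bound on the body may vary, as the cost of expanding a set depends on its
  size. The summands 1 pay for the tests.\<close>

lemma runs_Loop:
  assumes "P 0 s"
    and "\<And>i s'. i < N \<Longrightarrow> P i s' \<Longrightarrow> tval b s' \<and> runs c s' (T i) (P (Suc i))"
    and "\<And>s'. P N s' \<Longrightarrow> \<not> tval b s'"
  shows "runs (Loop b c) s (1 + (\<Sum>i<N. 1 + T i)) (P N)"
proof -
  \<comment> \<open>Generalised to a start after \<open>j\<close> iterations, by induction on the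
    number of iterations left.\<close>
  have "j \<le> N \<Longrightarrow> P j s' \<Longrightarrow> runs (Loop b c) s' (1 + (\<Sum>i = j..<N. 1 + T i)) (P N)" for j s'
  proof (induction "N - j" arbitrary: j s')
    case 0
    then show ?case
      using assms(3) exec.LoopFalse[of b s' c] unfolding runs_def by fastforce
  next
    case (Suc d)
    then have j: "j < N" by simp
    obtain t s1 where 1: "exec c s' t s1" "t \<le> T j" "P (Suc j) s1"
      using assms(2)[OF j Suc.prems(2)] by (auto simp: runs_def)
    obtain t' s2 where 2: "exec (Loop b c) s1 t' s2" "t' \<le> 1 + (\<Sum>i = Suc j..<N. 1 + T i)" "P N s2"
      using Suc.hyps(1)[of "Suc j" s1] Suc.hyps(2) j 1(3) unfolding runs_def by fastforce
    have "exec (Loop b c) s' (1 + t + t') s2"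
      using exec.LoopTrue 1(1) 2(1) assms(2)[OF j Suc.prems(2)] by blast
    moreover have "1 + t + t' \<le> 1 + (\<Sum>i = j..<N. 1 + T i)"
      using 1(2) 2(2) sum.atLeast_Suc_lessThan[OF j, of "\<lambda>i. 1 + T i"] by simp
    ultimately show ?case
      using 2(3) unfolding runs_def by blast
  qed
  from this[of 0 s] assms(1) show ?thesis
    by (simp add: atLeast0LessThan)
qed

section \<open>Loop-free code and unchanged variables\<close>

fun loop_free :: "com \<Rightarrow> bool" where
  "loop_free (Seq c1 c2) \<longleftrightarrow> loop_free c1 \<and> loop_free c2"
| "loop_free (Cond b c1 c2) \<longleftrightarrow> loop_free c1 \<and> loop_free c2"
| "loop_free (Loop b c) \<longleftrightarrow> False"
| "loop_free _ \<longleftrightarrow> True"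

text \<open>Executes loop-free blocks symbolically, so that simplification can verify them; the
  clause for \<open>Loop\<close> is a default value.\<close>

fun result :: "com \<Rightarrow> state \<Rightarrow> state" where
  "result Skip s = s"
| "result (IAssign x a) s = s\<lparr>ivars := (ivars s)(x := ival a s)\<rparr>"
| "result (RAssign x a) s = s\<lparr>rvars := (rvars s)(x := rval a s)\<rparr>"
| "result (Store a b) s = s\<lparr>mem := (mem s)(ival a s := ival b s)\<rparr>"
| "result (Seq c1 c2) s = result c2 (result c1 s)"
| "result (Cond b c1 c2) s = (if tval b s then result c1 s else result c2 s)"
| "result (Loop b c) s = s"

fun cost :: "com \<Rightarrow> nat" where
  "cost (Seq c1 c2) = cost c1 + cost c2"
| "cost (Cond b c1 c2) = 1 + max (cost c1) (cost c2)"
| "cost _ = 1"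

lemma exec_loop_free: "loop_free c \<Longrightarrow> \<exists>t \<le> cost c. exec c s t (result c s)"
proof (induction c arbitrary: s)
  case (Seq c1 c2)
  then obtain t1 t2 where "t1 \<le> cost c1" "t2 \<le> cost c2"
    "exec c1 s t1 (result c1 s)" "exec c2 (result c1 s) t2 (result c2 (result c1 s))"
    by (metis loop_free.simps(1))
  then show ?case
    using exec.Seq by (intro exI[of _ "t1 + t2"]) auto
next
  case (Cond b c1 c2)
  show ?case
  proof (cases "tval b s")
    case True
    with Cond obtain t where "t \<le> cost c1" "exec c1 s t (result c1 s)" by auto
    with True show ?thesis using exec.CondTrue by (intro exI[of _ "1 + t"]) auto
  next
    case False
    with Cond obtain t where "t \<le> cost c2" "exec c2 s t (result c2 s)" by auto
    with False show ?thesis using exec.CondFalse by (intro exI[of _ "1 + t"]) auto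
  qed
qed (auto intro: exec.intros[unfolded One_nat_def])

lemma runs_loop_free: "loop_free c \<Longrightarrow> Q (result c s) \<Longrightarrow> cost c \<le> T \<Longrightarrow> runs c s T Q"
  using exec_loop_free unfolding runs_def by (meson order_trans)

lemma runs_Seq_loop_free:
  assumes "loop_free c1" "runs c2 (result c1 s) T Q" "cost c1 + T \<le> T'"
  shows "runs (Seq c1 c2) s T' Q"
  by (rule runs_Seq[OF runs_loop_free[where Q = "\<lambda>s'. s' = result c1 s"]]) (use assms in auto)

definition frame :: "vname set \<Rightarrow> state \<Rightarrow> state \<Rightarrow> bool" where
  "frame X s s' \<longleftrightarrow> (\<forall>x. x \<notin> X \<longrightarrow> ivars s' x = ivars s x \<and> rvars s' x = rvars s x)"

lemma frame_trans: "frame X s s' \<Longrightarrow> frame Y s' s'' \<Longrightarrow> frame (X \<union> Y) s s''"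
  by (simp add: frame_def)

lemma frame_mono: "frame X s s' \<Longrightarrow> X \<subseteq> Y \<Longrightarrow> frame Y s s'"
  by (auto simp: frame_def)

lemma frame_ivars: "frame X s s' \<Longrightarrow> x \<notin> X \<Longrightarrow> ivars s' x = ivars s x"
  by (simp add: frame_def)

lemma frame_rvars: "frame X s s' \<Longrightarrow> x \<notin> X \<Longrightarrow> rvars s' x = rvars s x"
  by (simp add: frame_def)

lemmas frame_vars = frame_ivars frame_rvars

lemma of_bool_le_iff [simp]: "(1 :: int) \<le> of_bool P \<longleftrightarrow> P" "of_bool P \<le> (0 :: int) \<longleftrightarrow> \<not> P"
  by auto

abbreviation Then :: "com \<Rightarrow> com \<Rightarrow> com" (infixr ";;" 60) where
  "c1 ;; c2 \<equiv> Seq c1 c2"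

abbreviation Less :: "iexp \<Rightarrow> iexp \<Rightarrow> test" where
  "Less a b \<equiv> ILe (IAdd a (IConst 1)) b"

abbreviation Incr :: "vname \<Rightarrow> iexp \<Rightarrow> com" where
  "Incr x a \<equiv> IAssign x (IAdd (IVar x) a)"

definition For :: "vname \<Rightarrow> com \<Rightarrow> com" where
  "For x c = IAssign x (IConst 0) ;; Loop (Less (IVar x) (IVar ''n'')) (c ;; Incr x (IConst 1))"

text \<open>Per iteration, 2 pays for test and increment; outside, 2 pays for the initialisation and
  the last test. The invariant is required after the increment.\<close>

lemma runs_For:
  assumes n: "ivars s ''n'' = int n" and x: "x \<noteq> ''n''"
    and init: "P 0 (s\<lparr>ivars := (ivars s)(x := 0)\<rparr>)"
    and step: "\<And>i s'. i < n \<Longrightarrow> P i s' \<Longrightarrow> ivars s' x = int i \<Longrightarrow> ivars s' ''n'' = int n \<Longrightarrow>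
      runs c s' T (\<lambda>s''. ivars s'' x = int i \<and> ivars s'' ''n'' = int n \<and>
        P (Suc i) (s''\<lparr>ivars := (ivars s'')(x := int (Suc i))\<rparr>))"
  shows "runs (For x c) s (2 + n * (T + 2)) (P n)"
proof -
  let ?P = "\<lambda>i s'. P i s' \<and> ivars s' x = int i \<and> ivars s' ''n'' = int n"
  have "runs (Loop (Less (IVar x) (IVar ''n'')) (c ;; Incr x (IConst 1)))
      (s\<lparr>ivars := (ivars s)(x := 0)\<rparr>) (1 + (\<Sum>i<n. 1 + (T + 1))) (?P n)"
  proof (rule runs_Loop[where P = ?P])
    show "?P 0 (s\<lparr>ivars := (ivars s)(x := 0)\<rparr>)"
      using n x init by simp
    show "tval (Less (IVar x) (IVar ''n'')) s' \<and> runs (c ;; Incr x (IConst 1)) s' (T + 1) (?P (Suc i))"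
      if "i < n" "?P i s'" for i s'
    proof
      show "tval (Less (IVar x) (IVar ''n'')) s'" using that by simp
      show "runs (c ;; Incr x (IConst 1)) s' (T + 1) (?P (Suc i))"
        by (rule runs_Seq[OF step[of i s']]) (use that x in \<open>auto intro!: runs_IAssign simp: add.commute\<close>)
    qed
  qed simp
  then have "runs (Loop (Less (IVar x) (IVar ''n'')) (c ;; Incr x (IConst 1)))
      (s\<lparr>ivars := (ivars s)(x := 0)\<rparr>) (1 + n * (T + 2)) (P n)"
    by (rule runs_mono) auto
  then show ?thesis
    unfolding For_def by (intro runs_Seq_loop_free) auto
qed

section \<open>The program\<close>

text \<open>
  The adjacency matrix is followed, from address \<open>z = n\<^sup>2\<close> on, by records of \<open>n + 1\<close> cells that represent
  vertex sets: \<open>n\<close> membership bits and the cardinality. The first record is the empty set, \<open>e\<close> points to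
  the first free cell, \<open>a\<close> to the set being processed, and \<open>y\<close> to the end of the list of connected sets.
\<close>

text \<open>Computes \<open>acc\<close>, twice the value of set \<open>q\<close>, and \<open>touch\<close>, whether it touches set \<open>a\<close>.
  Pointer \<open>r\<close> tracks row \<open>u\<close> of the matrix because there is no multiplication.\<close>

definition eval_inner :: com where
  "eval_inner =
     Cond (ILe (IConst 1) (Load (IAdd (IVar ''r'') (IVar ''v''))))
       (Cond (ILe (IConst 1) (Load (IAdd (IVar ''a'') (IVar ''v'')))) (IAssign ''touch'' (IConst 1)) Skip ;;
        Cond (ILe (IConst 1) (Load (IAdd (IVar ''q'') (IVar ''v''))))
          (RAssign ''acc'' (RAdd (RVar ''acc'') (RVar ''alpha1'')))
          (RAssign ''acc'' (RAdd (RVar ''acc'') (RAdd (RVar ''alpha2'') (RVar ''alpha2'')))))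
       Skip"

definition eval_outer :: com where
  "eval_outer =
     Cond (ILe (IConst 1) (Load (IAdd (IVar ''q'') (IVar ''u''))))
       (Cond (ILe (IConst 1) (Load (IAdd (IVar ''a'') (IVar ''u'')))) (IAssign ''touch'' (IConst 1)) Skip ;;
        For ''v'' eval_inner)
       Skip ;;
     Incr ''r'' (IVar ''n'')"

definition eval_prog :: com where
  "eval_prog =
     (RAssign ''acc'' (OfInt (IConst 0)) ;; IAssign ''touch'' (IConst 0) ;; IAssign ''r'' (IConst 0)) ;;
     For ''u'' eval_outer"

text \<open>Meant for a vertex \<open>u\<close> outside set \<open>a\<close>: the cardinality is
  copied with 1 added, whatever the bit of \<open>u\<close> was.\<close>

definition append_prog :: com where
  "append_prog =
     For ''v'' (Store (IAdd (IVar ''e'') (IVar ''v'')) (Load (IAdd (IVar ''a'') (IVar ''v'')))) ;;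
     Store (IAdd (IVar ''e'') (IVar ''u'')) (IConst 1) ;;
     Store (IAdd (IVar ''e'') (IVar ''n'')) (IAdd (Load (IAdd (IVar ''a'') (IVar ''n''))) (IConst 1)) ;;
     Incr ''e'' (IAdd (IVar ''n'') (IConst 1))"

text \<open>Appends the extensions of set \<open>a\<close> by the vertices in or next to set \<open>b\<close>, or next to \<open>a\<close>;
  all vertices qualify if \<open>f0 = 1\<close>.\<close>

definition extend_inner :: com where
  "extend_inner =
     Cond (Conj (ILe (IConst 1) (Load (IAdd (IVar ''r'') (IVar ''v''))))
         (ILe (IConst 1) (IAdd (Load (IAdd (IVar ''a'') (IVar ''v''))) (Load (IAdd (IVar ''b'') (IVar ''v''))))))
       (IAssign ''f'' (IConst 1)) Skip"

definition extend_outer :: com where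
  "extend_outer =
     Cond (ILe (IConst 1) (Load (IAdd (IVar ''b'') (IVar ''u'')))) (IAssign ''f'' (IConst 1)) (IAssign ''f'' (IVar ''f0'')) ;;
     For ''v'' extend_inner ;;
     Cond (Conj (ILe (IConst 1) (IVar ''f'')) (ILe (Load (IAdd (IVar ''a'') (IVar ''u''))) (IConst 0))) append_prog Skip ;;
     Incr ''r'' (IVar ''n'')"

definition extend_prog :: com where
  "extend_prog = IAssign ''r'' (IConst 0) ;; For ''u'' extend_outer"

section \<open>Memory layout and correctness of the subroutines\<close>

context lgp
begin

definition adj_matrix :: "(int \<Rightarrow> int) \<Rightarrow> bool" where
  "adj_matrix m \<longleftrightarrow> (\<forall>u<n. \<forall>v<n. m (int (u * n) + int v) = of_bool (adj u v))"

definition is_record :: "(int \<Rightarrow> int) \<Rightarrow> int \<Rightarrow> nat set \<Rightarrow> bool" where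
  "is_record m a X \<longleftrightarrow> (\<forall>v<n. m (a + int v) = of_bool (v \<in> X)) \<and> m (a + int n) = int (card X)"

definition addr :: "nat \<Rightarrow> int" where
  "addr r = int (n * n + r * Suc n)"

text \<open>Zeros behind the last record make an empty set available there for free: moving
  \<open>e\<close> forward by one record appends it.\<close>

definition stores :: "(int \<Rightarrow> int) \<Rightarrow> nat set list \<Rightarrow> bool" where
  "stores m L \<longleftrightarrow> adj_matrix m \<and> (\<forall>r<length L. is_record m (addr r) (L ! r)) \<and>
     (\<forall>x \<ge> addr (length L). m x = 0) \<and> (\<forall>X \<in> set L. X \<subseteq> {..<n})"

lemma addr_Suc: "addr (Suc r) = addr r + (int n + 1)"
  by (simp add: addr_def algebra_simps)

lemma addr_mono: "r \<le> r' \<Longrightarrow> addr r \<le> addr r'"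
  unfolding addr_def by (intro zle_int[THEN iffD2] add_left_mono mult_right_mono) auto

lemma addr_less: "r < r' \<Longrightarrow> addr r + int n < addr r'"
  using addr_mono[of "Suc r" r'] by (simp add: addr_Suc)

lemma addr_less_iff: "addr r < addr r' \<longleftrightarrow> r < r'"
  using addr_less[of r r'] addr_mono[of r' r] by (meson linorder_not_less of_nat_0_le_iff order_le_less_trans le_add_same_cancel1)

lemma matrix_less: "u < n \<Longrightarrow> v < n \<Longrightarrow> int (u * n) + int v < addr r"
proof -
  assume "u < n" "v < n"
  then have "u * n + v < Suc u * n" by simp
  also have "\<dots> \<le> n * n" using \<open>u < n\<close> by (intro mult_right_mono) auto
  finally show ?thesis unfolding addr_def by linarith
qed

lemma stores_snoc:
  assumes L: "stores m L" and X: "X \<subseteq> {..<n}"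
    and m': "is_record m' (addr (length L)) X"
      "\<And>x. x < addr (length L) \<or> addr (Suc (length L)) \<le> x \<Longrightarrow> m' x = m x"
  shows "stores m' (L @ [X])"
proof -
  have "adj_matrix m'"
    using L m'(2) matrix_less by (simp add: stores_def adj_matrix_def)
  moreover have "is_record m' (addr r) ((L @ [X]) ! r)" if "r < Suc (length L)" for r
  proof (cases "r < length L")
    case True
    then have "m' (addr r + int v) = m (addr r + int v)" if "v \<le> n" for v
      using that addr_less[OF True] by (intro m'(2)) auto
    with True L show ?thesis
      by (simp add: stores_def is_record_def nth_append)
  next
    case False
    with that have "r = length L" by simp
    with m'(1) show ?thesis by simp
  qed
  moreover have "m' x = 0" if "addr (Suc (length L)) \<le> x" for x
    using that L m'(2)[of x] addr_mono[of "length L" "Suc (length L)"] by (auto simp: stores_def)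
  ultimately show ?thesis
    using L X by (auto simp: stores_def)
qed

text \<open>The invariant has the loop counter in place of \<open>n\<close>. The flag starts from
  \<open>b\<close>, what has been found before this loop; 5 is
  \<open>cost eval_inner\<close>.\<close>

lemma eval_inner_runs:
  assumes s: "ivars s ''n'' = int n" "ivars s ''u'' = int u" "ivars s ''r'' = int (u * n)" "u < n"
    "adj_matrix (mem s)" "is_record (mem s) (ivars s ''q'') D" "is_record (mem s) (ivars s ''a'') S"
    "rvars s ''alpha1'' = \<alpha>1" "rvars s ''alpha2'' = \<alpha>2" "ivars s ''touch'' = of_bool b"
  shows "runs (For ''v'' eval_inner) s (2 + n * (5 + 2)) (\<lambda>s'. frame {''v'', ''touch'', ''acc''} s s' \<and>
    mem s' = mem s \<and> ivars s' ''touch'' = of_bool (b \<or> (\<exists>v<n. adj u v \<and> v \<in> S)) \<and>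
    rvars s' ''acc'' = rvars s ''acc'' + (\<Sum>v | v < n \<and> adj u v. if v \<in> D then \<alpha>1 else 2 * \<alpha>2))"
proof (rule runs_For[OF s(1), where P = "\<lambda>i s'. frame {''v'', ''touch'', ''acc''} s s' \<and>
    mem s' = mem s \<and> ivars s' ''touch'' = of_bool (b \<or> (\<exists>v<i. adj u v \<and> v \<in> S)) \<and>
    rvars s' ''acc'' = rvars s ''acc'' + (\<Sum>v | v < i \<and> adj u v. if v \<in> D then \<alpha>1 else 2 * \<alpha>2)"], goal_cases)
  case (3 i s')
  note fr = frame_vars[OF conjunct1[OF 3(2)]]
  have "{v. v < Suc i \<and> adj u v} = (if adj u i then insert i {v. v < i \<and> adj u v} else {v. v < i \<and> adj u v})"
    by (auto simp: less_Suc_eq)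
  then have "(\<Sum>v | v < Suc i \<and> adj u v. if v \<in> D then \<alpha>1 else 2 * \<alpha>2) =
      (\<Sum>v | v < i \<and> adj u v. if v \<in> D then \<alpha>1 else 2 * \<alpha>2) +
      (if adj u i then if i \<in> D then \<alpha>1 else 2 * \<alpha>2 else 0)"
    by simp
  moreover have "(\<exists>v<Suc i. adj u v \<and> v \<in> S) \<longleftrightarrow> (\<exists>v<i. adj u v \<and> v \<in> S) \<or> adj u i \<and> i \<in> S"
    by (auto simp: less_Suc_eq)
  moreover have "mem s (int (u * n) + int i) = of_bool (adj u i)"
    "mem s (ivars s ''q'' + int i) = of_bool (i \<in> D)" "mem s (ivars s ''a'' + int i) = of_bool (i \<in> S)"
    using s 3(1) by (auto simp: adj_matrix_def is_record_def)
  ultimately show ?case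
    using 3 s by (intro runs_loop_free) (auto simp: eval_inner_def fr frame_def)
qed (use s in \<open>auto simp: frame_def\<close>)

lemma eval_outer_runs:
  assumes s: "ivars s ''n'' = int n" "ivars s ''u'' = int u" "ivars s ''r'' = int (u * n)" "u < n"
    "adj_matrix (mem s)" "is_record (mem s) (ivars s ''q'') D" "is_record (mem s) (ivars s ''a'') S"
    "rvars s ''alpha1'' = \<alpha>1" "rvars s ''alpha2'' = \<alpha>2" "ivars s ''touch'' = of_bool b"
  shows "runs eval_outer s (6 + n * 7) (\<lambda>s'. frame {''v'', ''r'', ''touch'', ''acc''} s s' \<and>
    mem s' = mem s \<and> ivars s' ''r'' = int (Suc u * n) \<and>
    ivars s' ''touch'' = of_bool (b \<or> u \<in> D \<and> (u \<in> S \<or> (\<exists>v<n. adj u v \<and> v \<in> S))) \<and>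
    rvars s' ''acc'' = rvars s ''acc'' +
      (if u \<in> D then \<Sum>v | v < n \<and> adj u v. if v \<in> D then \<alpha>1 else 2 * \<alpha>2 else 0))"
proof -
  let ?Q = "\<lambda>s'. frame {''v'', ''touch'', ''acc''} s s' \<and> mem s' = mem s \<and>
    ivars s' ''touch'' = of_bool (b \<or> u \<in> D \<and> (u \<in> S \<or> (\<exists>v<n. adj u v \<and> v \<in> S))) \<and>
    rvars s' ''acc'' = rvars s ''acc'' +
      (if u \<in> D then \<Sum>v | v < n \<and> adj u v. if v \<in> D then \<alpha>1 else 2 * \<alpha>2 else 0)"
  let ?P = "\<lambda>s'. frame {''touch''} s s' \<and> mem s' = mem s \<and> ivars s' ''touch'' = of_bool (b \<or> u \<in> S)"
  have mems: "mem s (ivars s ''q'' + int u) = of_bool (u \<in> D)" "mem s (ivars s ''a'' + int u) = of_bool (u \<in> S)"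
    using s by (auto simp: is_record_def)
  show ?thesis
    unfolding eval_outer_def
  proof (rule runs_Seq[where P = ?Q and ?T2.0 = 1, OF runs_Cond[where T = "2 + (2 + n * (5 + 2))"]], goal_cases)
    case 1
    then have "u \<in> D" using s mems by simp
    show ?case
    proof (rule runs_Seq[where P = ?P, OF _ _ order_refl])
      show "runs (Cond (ILe (IConst 1) (Load (IAdd (IVar ''a'') (IVar ''u'')))) (IAssign ''touch'' (IConst 1)) Skip) s 2 ?P"
        using s mems by (intro runs_loop_free) (auto simp: frame_def)
      show "runs (For ''v'' eval_inner) s' (2 + n * (5 + 2)) ?Q" if P: "?P s'" for s'
      proof -
        note fr = frame_vars[OF conjunct1[OF P]]
        show ?thesis
          by (rule runs_mono[OF eval_inner_runs[of s' u D S "b \<or> u \<in> S"]])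
            (use s P \<open>u \<in> D\<close> in \<open>auto simp: fr dest!: frame_trans[OF conjunct1[OF P]] elim!: frame_mono\<close>)
      qed
    qed
  next
    case 2
    then have "u \<notin> D" using s mems by simp
    then show ?case using s by (intro runs_loop_free) (auto simp: frame_def)
  next
    case (3 s')
    then show ?case using s
      by (intro runs_loop_free) (auto simp: frame_def algebra_simps)
  qed auto
qed

lemma eval_prog_runs:
  assumes s: "ivars s ''n'' = int n"
    "adj_matrix (mem s)" "is_record (mem s) (ivars s ''q'') D" "is_record (mem s) (ivars s ''a'') S"
    "rvars s ''alpha1'' = \<alpha>1" "rvars s ''alpha2'' = \<alpha>2" and D: "D \<subseteq> {..<n}" and S: "S \<subseteq> {..<n}"
  shows "runs eval_prog s (8 * Suc n ^ 2) (\<lambda>s'. frame {''u'', ''v'', ''r'', ''touch'', ''acc''} s s' \<and>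
    mem s' = mem s \<and> ivars s' ''touch'' = of_bool (touches E D S) \<and> rvars s' ''acc'' = dval D)"
proof -
  let ?X = "{''u'', ''v'', ''r'', ''touch'', ''acc''}"
  let ?w = "\<lambda>u. \<Sum>v | v < n \<and> adj u v. if v \<in> D then \<alpha>1 else 2 * \<alpha>2"
  let ?touch = "\<lambda>i. \<exists>u<i. u \<in> D \<and> (u \<in> S \<or> (\<exists>v<n. adj u v \<and> v \<in> S))"
  let ?P = "\<lambda>i s'. frame ?X s s' \<and> mem s' = mem s \<and> ivars s' ''r'' = int (i * n) \<and>
    ivars s' ''touch'' = of_bool (?touch i) \<and> rvars s' ''acc'' = (\<Sum>u | u < i \<and> u \<in> D. ?w u)"
  let ?s = "result (RAssign ''acc'' (OfInt (IConst 0)) ;; IAssign ''touch'' (IConst 0) ;; IAssign ''r'' (IConst 0)) s"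
  have loop: "runs (For ''u'' eval_outer) ?s (2 + n * ((6 + n * 7) + 2)) (?P n)"
  proof (rule runs_For[where P = ?P], goal_cases)
    case (4 i s')
    note fr = frame_vars[OF conjunct1[OF 4(2)]]
    have "{u. u < Suc i \<and> u \<in> D} = (if i \<in> D then insert i {u. u < i \<and> u \<in> D} else {u. u < i \<and> u \<in> D})"
      by (auto simp: less_Suc_eq)
    then have sum: "(\<Sum>u | u < Suc i \<and> u \<in> D. ?w u) = (\<Sum>u | u < i \<and> u \<in> D. ?w u) + (if i \<in> D then ?w i else 0)"
      by simp
    have ex: "?touch (Suc i) \<longleftrightarrow> ?touch i \<or> i \<in> D \<and> (i \<in> S \<or> (\<exists>v<n. adj i v \<and> v \<in> S))"
      by (auto simp: less_Suc_eq)
    show ?case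
      unfolding sum ex
      by (rule runs_mono[OF eval_outer_runs[of s' i D S "?touch i"]])
        (use 4 s in \<open>auto simp: fr frame_def\<close>)
  qed (use s in \<open>auto simp: frame_def\<close>)
  have touch: "?touch n \<longleftrightarrow> touches E D S"
    using D S unfolding touches_def adj_def by fastforce
  have "{u. u < n \<and> u \<in> D} = D"
    using D by auto
  then have sum: "(\<Sum>u | u < n \<and> u \<in> D. ?w u) = dval D"
    by (simp add: dval_def)
  show ?thesis
    unfolding eval_prog_def
    by (rule runs_Seq_loop_free[OF _ runs_mono[OF loop order_refl]])
      (use touch sum in \<open>auto simp: power2_eq_square algebra_simps\<close>)
qed


lemma append_prog_runs:
  assumes s: "ivars s ''n'' = int n" "ivars s ''u'' = int u" "u < n" "stores (mem s) L"
    "ivars s ''e'' = addr (length L)" "ivars s ''a'' = addr ra" "ra < length L" "u \<notin> L ! ra"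
  shows "runs append_prog s (5 + n * 3) (\<lambda>s'. frame {''v'', ''e''} s s' \<and>
    stores (mem s') (L @ [insert u (L ! ra)]) \<and> ivars s' ''e'' = addr (Suc (length L)))"
proof -
  let ?e = "addr (length L)" and ?S = "L ! ra"
  \<comment> \<open>\<open>?m i\<close> is the memory after \<open>i\<close> cells have been
    copied.\<close>
  let ?m = "\<lambda>i x. if ?e \<le> x \<and> x < ?e + int i then mem s (addr ra + (x - ?e)) else mem s x"
  have S: "is_record (mem s) (addr ra) ?S" "?S \<subseteq> {..<n}"
    using s by (auto simp: stores_def)
  \<comment> \<open>The source record ends before the first free cell, so copying never reads a cell
    that it has overwritten.\<close>
  have less: "addr ra + int n < ?e"
    using addr_less s by simp
  have 1: "runs (For ''v'' (Store (IAdd (IVar ''e'') (IVar ''v'')) (Load (IAdd (IVar ''a'') (IVar ''v''))))) s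
      (2 + n * (1 + 2)) (\<lambda>s'. frame {''v''} s s' \<and> mem s' = ?m n)"
  proof (rule runs_For[OF s(1), where P = "\<lambda>i s'. frame {''v''} s s' \<and> mem s' = ?m i"], goal_cases)
    case (3 i s')
    note fr = frame_vars[OF conjunct1[OF 3(2)]]
    show ?case
      by (rule runs_loop_free) (use 3 s less in \<open>auto simp: fr frame_def fun_eq_iff\<close>)
  qed (auto simp: frame_def)
  show ?thesis
    unfolding append_prog_def
  proof (rule runs_Seq[OF 1, where ?T2.0 = 3], goal_cases)
    case (1 s')
    note fr = frame_vars[OF conjunct1[OF 1]]
    let ?m' = "(?m n)(?e + int u := 1, ?e + int n := mem s (addr ra + int n) + 1)"
    have fin: "finite ?S" using S(2) finite_subset by blast
    have "is_record ?m' ?e (insert u ?S)"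
      using S s(3,8) fin by (auto simp: is_record_def)
    then have "stores ?m' (L @ [insert u ?S])"
      using s S(2) by (intro stores_snoc[of "mem s"]) (auto simp: addr_Suc)
    moreover have "?m n (addr ra + int n) = mem s (addr ra + int n)" "addr ra + int n \<noteq> ?e + int u"
      using less by auto
    ultimately show ?case
      using 1 s by (intro runs_loop_free) (auto simp: fr frame_def addr_Suc)
  qed auto
qed

text \<open>Tests have no primitive disjunction, so the program adds the bits of \<open>S\<close>
  and \<open>B\<close> at \<open>v\<close>: the sum is at least 1 iff \<open>v\<close> lies in the
  union.\<close>

lemma extend_inner_runs:
  assumes s: "ivars s ''n'' = int n" "ivars s ''u'' = int u" "ivars s ''r'' = int (u * n)" "u < n"
    "adj_matrix (mem s)" "is_record (mem s) (ivars s ''a'') S" "is_record (mem s) (ivars s ''b'') B"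
    "ivars s ''f'' = of_bool c"
  shows "runs (For ''v'' extend_inner) s (2 + n * (2 + 2)) (\<lambda>s'. frame {''v'', ''f''} s s' \<and>
    mem s' = mem s \<and> ivars s' ''f'' = of_bool (c \<or> (\<exists>v<n. adj u v \<and> v \<in> S \<union> B)))"
proof (rule runs_For[OF s(1), where P = "\<lambda>i s'. frame {''v'', ''f''} s s' \<and>
    mem s' = mem s \<and> ivars s' ''f'' = of_bool (c \<or> (\<exists>v<i. adj u v \<and> v \<in> S \<union> B))"], goal_cases)
  case (3 i s')
  note fr = frame_vars[OF conjunct1[OF 3(2)]]
  have "(\<exists>v<Suc i. adj u v \<and> v \<in> S \<union> B) \<longleftrightarrow> (\<exists>v<i. adj u v \<and> v \<in> S \<union> B) \<or> adj u i \<and> i \<in> S \<union> B"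
    by (auto simp: less_Suc_eq)
  moreover have "mem s (int (u * n) + int i) = of_bool (adj u i)"
    "mem s (ivars s ''a'' + int i) = of_bool (i \<in> S)" "mem s (ivars s ''b'' + int i) = of_bool (i \<in> B)"
    using s 3(1) by (auto simp: adj_matrix_def is_record_def)
  ultimately show ?case
    using 3 s by (intro runs_loop_free) (auto simp: extend_inner_def fr frame_def)
qed (use s in \<open>auto simp: frame_def\<close>)

lemma extend_outer_runs:
  assumes s: "ivars s ''n'' = int n" "ivars s ''u'' = int u" "ivars s ''r'' = int (u * n)" "u < n"
    "stores (mem s) L" "ivars s ''e'' = addr (length L)"
    "ivars s ''a'' = addr ra" "ivars s ''b'' = addr rb" "ra < length L" "rb < length L"
    "ivars s ''f0'' = of_bool c"
  defines "L' \<equiv> L @ (if u \<notin> L ! ra \<and> (c \<or> u \<in> L ! rb \<or> u \<in> nbhd (L ! ra \<union> L ! rb)) then [insert u (L ! ra)] else [])"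
  shows "runs extend_outer s (11 + n * 7) (\<lambda>s'. frame {''v'', ''r'', ''f'', ''e''} s s' \<and>
    stores (mem s') L' \<and> ivars s' ''e'' = addr (length L') \<and> ivars s' ''r'' = int (Suc u * n))"
proof -
  let ?S = "L ! ra" and ?B = "L ! rb"
  have rec: "adj_matrix (mem s)" "is_record (mem s) (addr ra) ?S" "is_record (mem s) (addr rb) ?B"
    and sub: "?S \<subseteq> {..<n}" "?B \<subseteq> {..<n}"
    using s by (auto simp: stores_def)
  have mems: "mem s (addr rb + int u) = of_bool (u \<in> ?B)" "mem s (addr ra + int u) = of_bool (u \<in> ?S)"
    using s rec by (auto simp: is_record_def)
  have nbhd: "u \<in> nbhd (?S \<union> ?B) \<longleftrightarrow> (\<exists>v<n. adj u v \<and> v \<in> ?S \<union> ?B)"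
    using s(4) sub by (auto simp: nbhd_def)
  let ?P = "\<lambda>s'. frame {''f''} s s' \<and> mem s' = mem s \<and> ivars s' ''f'' = of_bool (c \<or> u \<in> ?B)"
  let ?Q = "\<lambda>s'. frame {''v'', ''f''} s s' \<and> mem s' = mem s \<and>
    ivars s' ''f'' = of_bool (c \<or> u \<in> ?B \<or> u \<in> nbhd (?S \<union> ?B))"
  let ?R = "\<lambda>s'. frame {''v'', ''f'', ''e''} s s' \<and> stores (mem s') L' \<and> ivars s' ''e'' = addr (length L')"
  show ?thesis
    unfolding extend_outer_def
  proof (rule runs_Seq[where P = ?P and ?T1.0 = 2, OF _ runs_Seq[where P = ?Q and ?T1.0 = "2 + n * 4",
      OF _ runs_Seq[where P = ?R and ?T1.0 = "1 + (5 + n * 3)" and ?T2.0 = 1, OF _ _ order_refl] order_refl]], goal_cases)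
    case 1
    show ?case using s mems by (intro runs_loop_free) (auto simp: frame_def)
  next
    case (2 s')
    note fr = frame_vars[OF conjunct1[OF 2]]
    show ?case
      by (rule runs_mono[OF extend_inner_runs[of s' u ?S ?B "c \<or> u \<in> ?B"]])
        (use s 2 rec in \<open>auto simp: fr nbhd frame_def\<close>)
  next
    case (3 _ s')
    note fr = frame_vars[OF conjunct1[OF 3(2)]]
    show ?case
    proof (rule runs_Cond, goal_cases)
      case 1
      then have "u \<notin> ?S" "L' = L @ [insert u ?S]"
        using 3 mems s by (auto simp: fr L'_def)
      with 3 show ?case
        by (intro runs_mono[OF append_prog_runs[of s' u L ra]]) (use s in \<open>auto simp: fr frame_def\<close>)
    next
      case 2
      then have "L' = L"
        using 3 mems s by (auto simp: fr L'_def)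
      with 3 s show ?case
        by (intro runs_loop_free) (auto simp: fr frame_def)
    qed
  next
    case (4 _ _ s')
    note fr = frame_vars[OF conjunct1[OF 4(3)]]
    show ?case
      using 4(3) s by (intro runs_loop_free) (auto simp: fr frame_def algebra_simps)
  qed auto
qed

lemma extend_prog_runs:
  assumes s: "ivars s ''n'' = int n" "stores (mem s) L" "ivars s ''e'' = addr (length L)"
    "ivars s ''a'' = addr ra" "ivars s ''b'' = addr rb" "ra < length L" "rb < length L"
    "ivars s ''f0'' = of_bool c"
  defines "L' \<equiv> L @ extensions c (L ! ra) (L ! rb)"
  shows "runs extend_prog s (8 * Suc n ^ 2) (\<lambda>s'. frame {''u'', ''v'', ''r'', ''f'', ''e''} s s' \<and>
    stores (mem s') L' \<and> ivars s' ''e'' = addr (length L'))"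
proof -
  let ?X = "{''u'', ''v'', ''r'', ''f'', ''e''}" and ?s = "result (IAssign ''r'' (IConst 0)) s"
  define ok where "ok u \<longleftrightarrow> u \<notin> L ! ra \<and> (c \<or> u \<in> L ! rb \<or> u \<in> nbhd (L ! ra \<union> L ! rb))" for u
  \<comment> \<open>The list after the vertices below \<open>i\<close> have been tried. It grows
    only at its end, so the records at \<open>ra\<close> and \<open>rb\<close> stay valid while it
    grows.\<close>
  define Ls where "Ls i = L @ map (\<lambda>u. insert u (L ! ra)) (filter ok [0..<i])" for i
  have Ls_Suc: "Ls (Suc i) = Ls i @ (if ok i then [insert i (L ! ra)] else [])" for i
    by (simp add: Ls_def)
  have nth: "Ls i ! ra = L ! ra" "Ls i ! rb = L ! rb" "ra < length (Ls i)" "rb < length (Ls i)" for i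
    using s by (auto simp: Ls_def nth_append)
  let ?P = "\<lambda>i s'. frame ?X s s' \<and> stores (mem s') (Ls i) \<and> ivars s' ''e'' = addr (length (Ls i)) \<and>
    ivars s' ''r'' = int (i * n)"
  have loop: "runs (For ''u'' extend_outer) ?s (2 + n * ((11 + n * 7) + 2)) (?P n)"
  proof (rule runs_For[where P = ?P], goal_cases)
    case (4 i s')
    note fr = frame_vars[OF conjunct1[OF 4(2)]]
    have "runs extend_outer s' (11 + n * 7) (\<lambda>s''. frame {''v'', ''r'', ''f'', ''e''} s' s'' \<and>
      stores (mem s'') (Ls (Suc i)) \<and> ivars s'' ''e'' = addr (length (Ls (Suc i))) \<and> ivars s'' ''r'' = int (Suc i * n))"
      using extend_outer_runs[of s' i "Ls i" ra rb c] 4 s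
      unfolding Ls_Suc ok_def nth by (simp add: fr nth)
    then show ?case
      by (rule runs_mono) (use 4 s in \<open>auto simp: fr frame_def\<close>)
  qed (use s in \<open>auto simp: frame_def Ls_def\<close>)
  have "Ls n = L'"
    by (simp add: Ls_def L'_def extensions_def ok_def[abs_def])
  with loop show ?thesis
    unfolding extend_prog_def
    by (intro runs_Seq_loop_free[OF _ runs_mono[OF loop order_refl]])
      (auto simp: power2_eq_square algebra_simps)
qed

end

section \<open>Programs for the two searches\<close>

abbreviation Size :: "vname \<Rightarrow> iexp" where
  "Size x \<equiv> Load (IAdd (IVar x) (IVar ''n''))"

abbreviation Next :: "vname \<Rightarrow> com" where
  "Next x \<equiv> Incr x (IAdd (IVar ''n'') (IConst 1))"

fun At_least :: "goal \<Rightarrow> rexp \<Rightarrow> rexp \<Rightarrow> test" where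
  "At_least Maximize a b = RLe b a"
| "At_least Minimize a b = RLe a b"

lemma tval_At_least [simp]: "tval (At_least g a b) s \<longleftrightarrow> at_least g (rval a s) (rval b s)"
  by (cases g) (auto simp: at_least_def)

text \<open>\<open>b = z\<close> means that no candidate has been found yet: the record at \<open>z\<close> is the empty set.\<close>

definition scan_prog :: "goal \<Rightarrow> com" where
  "scan_prog g =
     Cond (Conj (ILe (Size ''q'') (IVar ''i'')) (ILe (IVar ''i'') (Size ''q'')))
       (eval_prog ;;
        Cond (Conj (ILe (IVar ''touch'') (IConst 0))
            (Neg (Conj (Neg (ILe (IVar ''b'') (IVar ''z''))) (Neg (At_least g (RVar ''acc'') (RVar ''best''))))))
          (IAssign ''b'' (IVar ''q'') ;; RAssign ''best'' (RVar ''acc'')) Skip)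
       Skip ;;
     Next ''q''"

text \<open>The list is ordered by size, so the scan can stop at the first set that is too large to
  fit beside set \<open>a\<close>. Only a prefix of the list is paid for, which is essential for the
  exponent in the time bound.\<close>

definition search_prog :: "goal \<Rightarrow> com" where
  "search_prog g =
     (IAssign ''b'' (IVar ''z'') ;; IAssign ''q'' (IVar ''z'')) ;;
     Loop (Conj (Less (IVar ''q'') (IVar ''y'')) (ILe (Size ''q'') (ISub (IVar ''k'') (Size ''a''))))
       (scan_prog g)"

text \<open>\<open>b = z\<close> makes set \<open>b\<close> empty, so that only neighbours of
  \<open>a\<close> qualify; \<open>f0\<close> is 1 exactly when set \<open>a\<close> is
  empty.\<close>

definition conn_prog :: com where
  "conn_prog =
     Cond (Less (Size ''a'') (IVar ''k''))
       ((IAssign ''b'' (IVar ''z'') ;;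
         Cond (ILe (Size ''a'') (IConst 0)) (IAssign ''f0'' (IConst 1)) (IAssign ''f0'' (IConst 0))) ;;
        extend_prog)
       Skip ;;
     Next ''a''"

text \<open>A set smaller than \<open>k\<close> is expanded, once for every size \<open>i\<close>; a
  set of size \<open>k\<close> is compared with the threshold, which is doubled by addition to match
  \<open>acc\<close>.\<close>

definition sol_prog :: "goal \<Rightarrow> com" where
  "sol_prog g =
     Cond (Less (Size ''a'') (IVar ''k''))
       ((IAssign ''f0'' (IConst 0) ;; IAssign ''i'' (IConst 1)) ;;
        Loop (ILe (IVar ''i'') (ISub (IVar ''k'') (Size ''a'')))
          (search_prog g ;; extend_prog ;; Incr ''i'' (IConst 1)))
       (IAssign ''q'' (IVar ''a'') ;; eval_prog ;;
        Cond (At_least g (RVar ''acc'') (OfInt (IAdd (IVar ''p'') (IVar ''p'')))) (IAssign ''out'' (IConst 1)) Skip) ;;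
     Next ''a''"

text \<open>The first loop computes \<open>z = n\<^sup>2\<close> by repeated addition. If
  \<open>k\<close> is not between 0 and \<open>n\<close>, \<open>out\<close> keeps its initial 0.
  Each \<open>Next ''e''\<close> appends an empty set as root of the search that follows;
  \<open>a\<close> then points at this root.\<close>

definition main_prog :: "goal \<Rightarrow> com" where
  "main_prog g =
     For ''u'' (Incr ''z'' (IVar ''n'')) ;;
     Cond (Conj (ILe (IConst 0) (IVar ''k'')) (ILe (IVar ''k'') (IVar ''n'')))
       ((IAssign ''a'' (IVar ''z'') ;; IAssign ''e'' (IVar ''z'') ;; Next ''e'') ;;
        Loop (Less (IVar ''a'') (IVar ''e'')) conn_prog ;;
        (IAssign ''y'' (IVar ''e'') ;; Next ''e'') ;;
        Loop (Less (IVar ''a'') (IVar ''e'')) (sol_prog g))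
       Skip"

section \<open>Correctness and cost of the two searches\<close>

context lgp
begin

definition ready :: "int \<Rightarrow> nat set list \<Rightarrow> state \<Rightarrow> bool" where
  "ready p L s \<longleftrightarrow> ivars s ''n'' = int n \<and> ivars s ''k'' = int k \<and> ivars s ''p'' = p \<and>
     rvars s ''alpha1'' = \<alpha>1 \<and> rvars s ''alpha2'' = \<alpha>2 \<and> ivars s ''z'' = addr 0 \<and>
     stores (mem s) L \<and> ivars s ''e'' = addr (length L)"

lemma ready_size:
  "ready p L s \<Longrightarrow> r < length L \<Longrightarrow> mem s (addr r + int n) = int (card (L ! r))"
  by (simp add: ready_def stores_def is_record_def)

lemma ready_record:
  assumes "ready p L s" "r < length L"
  shows "is_record (mem s) (addr r) (L ! r)" "L ! r \<subseteq> {..<n}"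
  using assms by (auto simp: ready_def stores_def)

lemma conn_upto_nth_0: "conn_upto m ! 0 = {}" "0 < length (conn_upto m)"
  by (simp_all add: levels_def upt_conv_Cons del: upt_Suc)

text \<open>Behind the prefix of sets of size at most \<open>m\<close>, the next set, if any, is
  larger. This makes the stopping test of the scan correct.\<close>

lemma conn_upto_mono:
  assumes "m \<le> l"
  shows "conn_upto l = conn_upto m @ drop (length (conn_upto m)) (conn_upto l)"
    and "length (conn_upto m) < length (conn_upto l) \<Longrightarrow> m < card (conn_upto l ! length (conn_upto m))"
proof -
  let ?rest = "concat (map (level conn_kids {}) [Suc m..<Suc l])"
  have eq: "conn_upto l = conn_upto m @ ?rest"
    using assms by (rule levels_split)
  then show "conn_upto l = conn_upto m @ drop (length (conn_upto m)) (conn_upto l)"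
    by simp
  assume "length (conn_upto m) < length (conn_upto l)"
  with eq have "conn_upto l ! length (conn_upto m) \<in> set ?rest"
    by (metis add_cancel_right_right length_append length_greater_0_conv nat_less_le nth_append_length_plus
        nth_mem list.size(3))
  then obtain i where "m < i" "conn_upto l ! length (conn_upto m) \<in> set (level conn_kids {} i)"
    by (auto simp: Suc_le_eq simp del: upt_Suc)
  then show "m < card (conn_upto l ! length (conn_upto m))"
    using conn_level by auto
qed

text \<open>The candidate is kept as an index \<open>rb\<close>. Index 0 holds the empty set and
  means none, so the test \<open>b \<le> z\<close> decides emptiness; \<open>best\<close> is
  constrained only for \<open>rb \<noteq> 0\<close>.\<close>

lemma scan_prog_runs:
  assumes s: "ready p L s" and r: "r < length L" "ra < length L" "rb < length L"
    and v: "ivars s ''q'' = addr r" "ivars s ''a'' = addr ra" "ivars s ''i'' = int i" "0 < i" "ivars s ''b'' = addr rb"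
      "rb = 0 \<longleftrightarrow> L ! rb = {}" "rb \<noteq> 0 \<Longrightarrow> rvars s ''best'' = dval (L ! rb)" "L ! 0 = {}"
  shows "runs (scan_prog g) s (13 * Suc n ^ 2) (\<lambda>s'. frame {''u'', ''v'', ''r'', ''touch'', ''acc'', ''b'', ''best'', ''q''} s s' \<and>
    mem s' = mem s \<and> ivars s' ''q'' = addr (Suc r) \<and> (\<exists>rb' < length L. ivars s' ''b'' = addr rb' \<and>
      L ! rb' = pick (L ! ra) i (L ! r) (L ! rb) \<and> (rb' = 0 \<longleftrightarrow> L ! rb' = {}) \<and>
      (rb' \<noteq> 0 \<longrightarrow> rvars s' ''best'' = dval (L ! rb'))))"
proof -
  let ?Q = "\<lambda>s'. frame {''u'', ''v'', ''r'', ''touch'', ''acc'', ''b'', ''best''} s s' \<and>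
    mem s' = mem s \<and> (\<exists>rb' < length L. ivars s' ''b'' = addr rb' \<and>
      L ! rb' = pick (L ! ra) i (L ! r) (L ! rb) \<and> (rb' = 0 \<longleftrightarrow> L ! rb' = {}) \<and>
      (rb' \<noteq> 0 \<longrightarrow> rvars s' ''best'' = dval (L ! rb')))"
  let ?P = "\<lambda>s'. frame {''u'', ''v'', ''r'', ''touch'', ''acc''} s s' \<and>
    mem s' = mem s \<and> ivars s' ''touch'' = of_bool (touches E (L ! r) (L ! ra)) \<and> rvars s' ''acc'' = dval (L ! r)"
  have b0: "addr rb \<le> addr 0 \<longleftrightarrow> L ! rb = {}"
    using v(6) addr_less_iff[of 0 rb] by auto
  have best: "L ! rb = {} \<or> rvars s ''best'' = dval (L ! rb)"
    using v(6,7) by auto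
  note env = s[unfolded ready_def]
  have "Suc 0 \<le> Suc n ^ 2" by simp
  then show ?thesis
    unfolding scan_prog_def
  proof (intro runs_Seq[where P = ?Q and ?T2.0 = 1, OF runs_Cond[where T = "8 * Suc n ^ 2 + 3"]], goal_cases)
    case 1
    then have card: "card (L ! r) = i"
      using v env ready_size[OF s r(1)] by simp
    \<comment> \<open>\<open>0 < i\<close> excludes the empty set, so a new candidate never has
      index 0.\<close>
    then have "L ! r \<noteq> {}" using v(4) by auto
    then have r0: "r \<noteq> 0" "L ! r \<noteq> {}" using v(8) by metis+
    show ?case
    proof (rule runs_Seq[where P = ?P, OF _ _ order_refl], goal_cases)
      case 1
      show ?case
        by (rule eval_prog_runs) (use env v ready_record[OF s] r in \<open>auto simp: stores_def\<close>)
    next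
      case (2 s')
      note fr = frame_vars[OF conjunct1[OF 2]]
      show ?case
      proof (cases "\<not> touches E (L ! r) (L ! ra) \<and> (L ! rb = {} \<or> at_least g (dval (L ! r)) (dval (L ! rb)))")
        case True
        then have "pick (L ! ra) i (L ! r) (L ! rb) = L ! r"
          by (simp add: pick_def card)
        then show ?thesis
          using 2 True env v(1-6,8) best r r0 b0
          by (intro runs_loop_free) (auto simp: fr frame_def intro!: exI[of _ r])
      next
        case False
        then have "pick (L ! ra) i (L ! r) (L ! rb) = L ! rb"
          by (auto simp: pick_def)
        then show ?thesis
          using 2 False env v(1-6,8) best r r0 b0
          by (intro runs_loop_free) (auto simp: fr frame_def intro!: exI[of _ rb])
      qed
    qed
  next
    case 2
    then have "card (L ! r) \<noteq> i"
      using v env ready_size[OF s r(1)] by auto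
    then have "pick (L ! ra) i (L ! r) (L ! rb) = L ! rb"
      by (auto simp: pick_def)
    then show ?case
      using env v r by (intro runs_loop_free) (auto simp: frame_def intro!: exI[of _ rb])
  next
    case (3 s')
    note fr = frame_vars[OF conjunct1[OF 3(2)]]
    show ?case
      using 3 env v by (intro runs_loop_free) (auto simp: fr frame_def addr_Suc)
  qed auto
qed

lemma search_prog_runs:
  assumes s: "ready p L s" and L: "L = conn_upto k @ L'" and ra: "ra < length L" "card (L ! ra) < k"
    and v: "ivars s ''y'' = addr (length (conn_upto k))" "ivars s ''a'' = addr ra" "ivars s ''i'' = int i" "0 < i"
  shows "runs (search_prog g) s (17 * Suc n ^ 2 * length (conn_upto (k - card (L ! ra))))
    (\<lambda>s'. frame {''u'', ''v'', ''r'', ''touch'', ''acc'', ''b'', ''best'', ''q''} s s' \<and> mem s' = mem s \<and>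
      (\<exists>rb < length L. ivars s' ''b'' = addr rb \<and> L ! rb = best (L ! ra) i))"
proof -
  let ?X = "{''u'', ''v'', ''r'', ''touch'', ''acc'', ''b'', ''best'', ''q''}"
  let ?S = "L ! ra" and ?s = "result (IAssign ''b'' (IVar ''z'') ;; IAssign ''q'' (IVar ''z'')) s"
  define m where "m = k - card ?S"
  define F where "F = conn_upto m"
  note env = s[unfolded ready_def]
  \<comment> \<open>\<open>F\<close> is the prefix to be scanned and \<open>R\<close> the rest,
    whose first set, if any, is too large.\<close>
  obtain R where R: "conn_upto k = F @ R" "R \<noteq> [] \<Longrightarrow> m < card (R ! 0)"
    using conn_upto_mono[of m k] unfolding F_def m_def
    by (metis append_Nil2 diff_le_self length_append length_greater_0_conv less_add_same_cancel1 nth_append_length_plus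
        add_0_right)
  have L0: "L ! 0 = {}" "0 < length L"
    using conn_upto_nth_0[of k] by (auto simp: L nth_append)
  have nth: "L ! r = F ! r" "r < length L" "r < length (conn_upto k)" if "r < length F" for r
    using that by (auto simp: L R nth_append)
  let ?P = "\<lambda>r s'. frame ?X s s' \<and> mem s' = mem s \<and> ivars s' ''q'' = addr r \<and>
    (\<exists>rb < length L. ivars s' ''b'' = addr rb \<and> L ! rb = fold (pick ?S i) (take r F) {} \<and>
      (rb = 0 \<longleftrightarrow> L ! rb = {}) \<and> (rb \<noteq> 0 \<longrightarrow> rvars s' ''best'' = dval (L ! rb)))"
  have "runs (Loop (Conj (Less (IVar ''q'') (IVar ''y'')) (ILe (Size ''q'') (ISub (IVar ''k'') (Size ''a''))))
      (scan_prog g)) ?s (1 + (\<Sum>r<length F. 1 + 13 * Suc n ^ 2)) (?P (length F))"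
  proof (rule runs_Loop[where P = ?P], goal_cases)
    case 1
    show ?case
      using env L0 by (auto simp: frame_def intro!: exI[of _ 0])
  next
    case (2 r s')
    note fr = frame_vars[OF conjunct1[OF 2(2)]]
    note r = nth[OF 2(1)]
    from 2 obtain rb where rb: "rb < length L" "ivars s' ''b'' = addr rb"
      "L ! rb = fold (pick ?S i) (take r F) {}" "rb = 0 \<longleftrightarrow> L ! rb = {}"
      "rb \<noteq> 0 \<Longrightarrow> rvars s' ''best'' = dval (L ! rb)"
      by blast
    have "card (L ! r) \<le> m"
      using r(1) 2(1) conn_uptoD[of "F ! r" m] by (simp add: F_def)
    then have "tval (Conj (Less (IVar ''q'') (IVar ''y'')) (ILe (Size ''q'') (ISub (IVar ''k'') (Size ''a'')))) s'"
      using 2(2) v env ra ready_size[OF s ra(1)] ready_size[OF s r(2)] addr_less_iff[of r "length (conn_upto k)"] r(3)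
      by (simp add: fr m_def)
    moreover have "ready p L s'"
      using 2(2) env by (simp add: ready_def fr)
    then have "runs (scan_prog g) s' (13 * Suc n ^ 2) (?P (Suc r))"
      by (rule runs_mono[OF scan_prog_runs[of p L s' r ra rb i] order_refl])
        (use 2 rb r ra v L0 in \<open>auto simp: fr frame_def take_Suc_conv_app_nth\<close>)
    ultimately show ?case by blast
  next
    case (3 s')
    note fr = frame_vars[OF conjunct1[OF 3]]
    show ?case
    \<comment> \<open>Either \<open>q\<close> has reached the end \<open>y\<close> of the list, or
      the size test fails at the first set of \<open>R\<close>.\<close>
    proof (cases "R = []")
      case True
      then show ?thesis
        using 3 v by (simp add: fr R)
    next
      case False
      then have "length F < length L" "L ! length F = R ! 0"
        by (auto simp: L R nth_append)
      with R(2)[OF False] show ?thesis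
        using 3 v env ready_size[OF s ra(1)] ready_size[OF s, of "length F"] ra(2) by (auto simp: fr m_def)
    qed
  qed
  note loop = this
  have "0 < length F" using conn_upto_nth_0 by (simp add: F_def)
  then have "1 \<le> Suc n ^ 2 * length F" "length F \<le> Suc n ^ 2 * length F"
    by (auto simp: Suc_le_eq)
  then have "3 + length F + 13 * (Suc n ^ 2 * length F) \<le> 17 * (Suc n ^ 2 * length F)"
    by linarith
  then have "3 + length F * (1 + 13 * Suc n ^ 2) \<le> 17 * Suc n ^ 2 * length F"
    by (simp only: algebra_simps mult_1_right)
  then show ?thesis
    unfolding search_prog_def
    by (intro runs_Seq_loop_free[OF _ runs_mono[OF loop order_refl]]) (auto simp: best_def F_def m_def)
qed


lemma conn_unfold: "conn_upto k = {} # concat (map conn_kids (conn_upto k))"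
  by (rule levels_unfold[OF conn_level_Suc_k])

lemma sol_unfold: "levels sol_kids {} k = {} # concat (map sol_kids (levels sol_kids {} k))"
  by (rule levels_unfold[OF sol_level_Suc_k])

lemma conn_subset: "S \<in> set (conn_upto k) \<Longrightarrow> S \<subseteq> {..<n}"
  using conn_uptoD by blast

lemma sol_subset: "S \<in> set (levels sol_kids {} k) \<Longrightarrow> S \<subseteq> {..<n} \<and> card S \<le> k"
  unfolding set_levels using sol_level by auto

lemma conn_prog_runs:
  assumes s: "ready p L s" and r: "r < length L" "ivars s ''a'' = addr r" "L ! 0 = {}"
  shows "runs conn_prog s (13 * Suc n ^ 2) (\<lambda>s'. frame {''u'', ''v'', ''r'', ''f'', ''f0'', ''b'', ''e'', ''a''} s s' \<and>
    ready p (L @ conn_kids (L ! r)) s' \<and> ivars s' ''a'' = addr (Suc r))"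
proof -
  let ?S = "L ! r"
  let ?Q = "\<lambda>s'. frame {''u'', ''v'', ''r'', ''f'', ''f0'', ''b'', ''e''} s s' \<and> ready p (L @ conn_kids ?S) s'"
  note env = s[unfolded ready_def]
  have S: "mem s (addr r + int n) = int (card ?S)" "finite ?S"
    using ready_size[OF s r(1)] ready_record(2)[OF s r(1)] finite_subset by auto
  have "Suc 0 \<le> Suc n ^ 2" by simp
  then show ?thesis
    unfolding conn_prog_def
  proof (intro runs_Seq[where P = ?Q and ?T2.0 = 1, OF runs_Cond[where T = "3 + 8 * Suc n ^ 2"]], goal_cases)
    case 1
    then have kids: "conn_kids ?S = extensions (?S = {}) ?S (L ! 0)"
      using S env r by (simp add: conn_kids_def)
    let ?s = "result (IAssign ''b'' (IVar ''z'') ;;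
      Cond (ILe (Size ''a'') (IConst 0)) (IAssign ''f0'' (IConst 1)) (IAssign ''f0'' (IConst 0))) s"
    have "runs extend_prog ?s (8 * Suc n ^ 2) (\<lambda>s'. frame {''u'', ''v'', ''r'', ''f'', ''e''} ?s s' \<and>
        stores (mem s') (L @ extensions (?S = {}) ?S (L ! 0)) \<and>
        ivars s' ''e'' = addr (length (L @ extensions (?S = {}) ?S (L ! 0))))"
      by (rule extend_prog_runs) (use env r S in auto)
    then have "runs extend_prog ?s (8 * Suc n ^ 2) ?Q"
      by (rule runs_mono) (use env S r in \<open>auto simp: kids ready_def frame_def split: if_splits\<close>)
    then show ?case
      by (rule runs_Seq_loop_free[rotated]) auto
  next
    case 2
    then have "conn_kids ?S = []"
      using S env r by (simp add: conn_kids_def)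
    then show ?case
      using s by (intro runs_loop_free) (auto simp: frame_def)
  next
    case (3 s')
    note fr = frame_vars[OF conjunct1[OF 3(2)]]
    show ?case
      using 3 env r by (intro runs_loop_free) (auto simp: fr frame_def ready_def addr_Suc)
  qed auto
qed

text \<open>The invariant is the queue after \<open>r\<close> expansions. By
  \<open>queue_nonempty\<close>, with cardinality as rank, \<open>a\<close> does not catch up with
  \<open>e\<close> before the final list is complete.\<close>

lemma conn_loop_runs:
  assumes s: "ready p [{}] s" "ivars s ''a'' = addr 0" "ivars s ''out'' = 0"
  shows "runs (Loop (Less (IVar ''a'') (IVar ''e'')) conn_prog) s (1 + (\<Sum>r<length (conn_upto k). 1 + 13 * Suc n ^ 2))
    (\<lambda>s'. ready p (conn_upto k) s' \<and> ivars s' ''a'' = addr (length (conn_upto k)) \<and> ivars s' ''out'' = 0)"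
proof -
  let ?F = "conn_upto k"
  let ?q = "queue conn_kids {} ?F"
  let ?P = "\<lambda>r s'. ready p (?q r) s' \<and> ivars s' ''a'' = addr r \<and> ivars s' ''out'' = 0"
  have "runs (Loop (Less (IVar ''a'') (IVar ''e'')) conn_prog) s (1 + (\<Sum>r<length ?F. 1 + 13 * Suc n ^ 2)) (?P (length ?F))"
  proof (rule runs_Loop[where P = ?P], goal_cases)
    case 1
    show ?case using s by (simp add: queue_0)
  next
    case (2 r s')
    have r: "r < length (?q r)"
      by (rule queue_nonempty[OF conn_unfold _ 2(1), where rank = card]) (auto dest!: conn_kid[OF conn_subset])
    then have nth: "?q r ! r = ?F ! r" by (rule queue_nth[OF conn_unfold])
    have "runs conn_prog s' (13 * Suc n ^ 2) (?P (Suc r))"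
      by (rule runs_mono[OF conn_prog_runs[of p "?q r" s' r]])
        (use 2 r in \<open>auto simp: nth queue_Suc frame_def, auto simp: queue_def\<close>)
    then show ?case
      using 2 r addr_less_iff[of r "length (?q r)"] by (simp add: ready_def)
  next
    case (3 s')
    then show ?case by (simp add: queue_length[OF conn_unfold] ready_def)
  qed
  then show ?thesis
    by (simp add: queue_length[OF conn_unfold])
qed

lemma sol_prog_runs:
  assumes s: "ready p L s" and L: "L = conn_upto k @ L'" and r: "r < length L" "ivars s ''a'' = addr r"
    and y: "ivars s ''y'' = addr (length (conn_upto k))" and k: "k \<le> n" "card (L ! r) \<le> k"
    and out: "ivars s ''out'' = of_bool c"
  shows "runs (sol_prog g) s (32 * Suc n ^ 3 * length (conn_upto (k - card (L ! r))))
    (\<lambda>s'. ready p (L @ sol_kids (L ! r)) s' \<and> ivars s' ''a'' = addr (Suc r) \<and>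
      ivars s' ''y'' = addr (length (conn_upto k)) \<and>
      ivars s' ''out'' = of_bool (c \<or> card (L ! r) = k \<and> at_least g (dval (L ! r)) (2 * of_int p)))"
proof -
  let ?S = "L ! r"
  define N where "N = length (conn_upto (k - card ?S))"
  let ?Q = "\<lambda>s'. ready p (L @ sol_kids ?S) s' \<and> ivars s' ''a'' = addr r \<and>
    ivars s' ''y'' = addr (length (conn_upto k)) \<and>
    ivars s' ''out'' = of_bool (c \<or> card ?S = k \<and> at_least g (dval ?S) (2 * of_int p))"
  note env = s[unfolded ready_def]
  have S: "mem s (addr r + int n) = int (card ?S)" "?S \<subseteq> {..<n}"
    using ready_size[OF s r(1)] ready_record(2)[OF s r(1)] by auto
  have N: "0 < N" using conn_upto_nth_0 by (simp add: N_def)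
  \<comment> \<open>25 is 17 for the search plus 8 for the extension, for at most \<open>n\<close>
    sizes \<open>i\<close>. The terms 3 and \<open>8 * Suc n ^ 2\<close> leave room for the other
    branch, which evaluates a set of size \<open>k\<close>.\<close>
  let ?T = "3 + n * (1 + (25 * Suc n ^ 2 * N + 1)) + 8 * Suc n ^ 2"
  have T: "1 + ?T + 1 \<le> 32 * Suc n ^ 3 * N"
  proof -
    obtain N' where "N = Suc N'" using N gr0_implies_Suc by blast
    then show ?thesis by (simp add: power2_eq_square power3_eq_cube algebra_simps)
  qed
  have "runs (sol_prog g) s (32 * Suc n ^ 3 * N) (\<lambda>s'. ready p (L @ sol_kids ?S) s' \<and> ivars s' ''a'' = addr (Suc r) \<and>
      ivars s' ''y'' = addr (length (conn_upto k)) \<and>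
      ivars s' ''out'' = of_bool (c \<or> card ?S = k \<and> at_least g (dval ?S) (2 * of_int p)))"
    unfolding sol_prog_def
  proof (rule runs_Seq[where P = ?Q and ?T2.0 = 1, OF runs_Cond[where T = ?T] _ T], goal_cases)
    case 1
    then have less: "card ?S < k"
      using S env r by simp
    \<comment> \<open>The list after the sizes 1 to \<open>j\<close> have been processed; the record
      of \<open>?S\<close> stays in place because the list grows at its end.\<close>
    define Ls where "Ls j = L @ concat (map (\<lambda>i. extensions False ?S (best ?S i)) [1..<Suc j])" for j
    have Ls: "Ls 0 = L" "Ls (Suc j) = Ls j @ extensions False ?S (best ?S (Suc j))" "Ls (k - card ?S) = L @ sol_kids ?S" for j
      using less by (simp_all add: Ls_def sol_kids_def)
    have nth: "Ls j ! r = ?S" "r < length (Ls j)" for j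
      using r by (auto simp: Ls_def nth_append)
    let ?s = "result (IAssign ''f0'' (IConst 0) ;; IAssign ''i'' (IConst 1)) s"
    let ?P = "\<lambda>j s'. ready p (Ls j) s' \<and> ivars s' ''a'' = addr r \<and> ivars s' ''y'' = addr (length (conn_upto k)) \<and>
      ivars s' ''out'' = of_bool c \<and> ivars s' ''f0'' = 0 \<and> ivars s' ''i'' = int (Suc j)"
    let ?body = "search_prog g ;; extend_prog ;; Incr ''i'' (IConst 1)"
    have loop: "runs (Loop (ILe (IVar ''i'') (ISub (IVar ''k'') (Size ''a''))) ?body) ?s
        (1 + (\<Sum>j<k - card ?S. 1 + (25 * Suc n ^ 2 * N + 1))) (?P (k - card ?S))"
    proof (rule runs_Loop[where P = ?P], goal_cases)
      case 1
      show ?case using env y r out by (simp add: Ls ready_def)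
    next
      case (2 j s')
      note \<open>?P j s'\<close>
      from 2 have s': "ready p (Ls j) s'" by simp
      note env' = s'[unfolded ready_def]
      have "tval (ILe (IVar ''i'') (ISub (IVar ''k'') (Size ''a''))) s'"
        using 2 ready_size[OF s' nth(2)] env' less by (simp add: nth)
      moreover have "runs ?body s' (25 * Suc n ^ 2 * N + 1) (?P (Suc j))"
      proof -
        let ?R1 = "\<lambda>s''. frame {''u'', ''v'', ''r'', ''touch'', ''acc'', ''b'', ''best'', ''q''} s' s'' \<and> mem s'' = mem s' \<and>
          (\<exists>rb < length (Ls j). ivars s'' ''b'' = addr rb \<and> Ls j ! rb = best ?S (Suc j))"
        let ?R2 = "\<lambda>s''. frame {''u'', ''v'', ''r'', ''touch'', ''acc'', ''b'', ''best'', ''q'', ''f'', ''e''} s' s'' \<and>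
          stores (mem s'') (Ls (Suc j)) \<and> ivars s'' ''e'' = addr (length (Ls (Suc j)))"
        show ?thesis
        proof (rule runs_Seq[where P = ?R1 and ?T1.0 = "17 * Suc n ^ 2 * N", OF _ runs_Seq[where
            P = ?R2 and ?T1.0 = "8 * Suc n ^ 2" and ?T2.0 = 1, OF _ _ order_refl]], goal_cases)
          case 1
          show ?case
            using search_prog_runs[OF s', of _ r "Suc j"] 2 nth[of j] less by (simp add: Ls_def L N_def)
        next
          case (2 s1)
          note fr = frame_vars[OF conjunct1[OF 2]]
          obtain rb where rb: "rb < length (Ls j)" "ivars s1 ''b'' = addr rb" "Ls j ! rb = best ?S (Suc j)"
            using 2 by blast
          have "runs extend_prog s1 (8 * Suc n ^ 2) (\<lambda>s'. frame {''u'', ''v'', ''r'', ''f'', ''e''} s1 s' \<and>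
              stores (mem s') (Ls j @ extensions False (Ls j ! r) (Ls j ! rb)) \<and>
              ivars s' ''e'' = addr (length (Ls j @ extensions False (Ls j ! r) (Ls j ! rb))))"
            by (rule extend_prog_runs) (use 2 \<open>?P j s'\<close> env' nth rb in \<open>auto simp: fr\<close>)
          then show ?case
            by (rule runs_mono) (use 2 in \<open>auto simp: Ls nth rb frame_def\<close>)
        next
          case (3 _ s2)
          note fr = frame_vars[OF conjunct1[OF 3(2)]]
          show ?case
            using 3(2) \<open>?P j s'\<close> env' by (intro runs_loop_free) (auto simp: fr ready_def)
        next
          case 4
          show ?case using N by (cases N) (auto simp: algebra_simps)
        qed
      qed
      ultimately show ?case by blast
    next
      case (3 s')
      then have s': "ready p (Ls (k - card ?S)) s'" by simp
      show ?case
        using 3 ready_size[OF s' nth(2)] s'[unfolded ready_def] less by (simp add: nth)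
    qed
    have "runs (Loop (ILe (IVar ''i'') (ISub (IVar ''k'') (Size ''a''))) ?body) ?s
        (1 + n * (1 + (25 * Suc n ^ 2 * N + 1))) ?Q"
    proof (rule runs_mono[OF loop])
      have "k - card ?S \<le> n" using k(1) by simp
      then show "1 + (\<Sum>j<k - card ?S. 1 + (25 * Suc n ^ 2 * N + 1)) \<le> 1 + n * (1 + (25 * Suc n ^ 2 * N + 1))"
        unfolding sum_constant card_lessThan of_nat_id by (intro add_left_mono mult_right_mono) auto
    qed (use less in \<open>auto simp: Ls\<close>)
    then show ?case
      by (rule runs_Seq_loop_free[rotated]) auto
  next
    case 2
    then have eq: "card ?S = k" "sol_kids ?S = []"
      using S env r k by (auto simp: sol_kids_def)
    let ?s = "result (IAssign ''q'' (IVar ''a'')) s"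
    let ?P = "\<lambda>s'. frame {''u'', ''v'', ''r'', ''touch'', ''acc''} ?s s' \<and>
      mem s' = mem ?s \<and> ivars s' ''touch'' = of_bool (touches E ?S ?S) \<and> rvars s' ''acc'' = dval ?S"
    show ?case
    proof (rule runs_Seq_loop_free[OF _ runs_Seq[where P = ?P and ?T1.0 = "8 * Suc n ^ 2" and ?T2.0 = 2, OF _ _ order_refl]], goal_cases)
      case 2
      show ?case
        by (rule eval_prog_runs) (use env r S ready_record(1)[OF s r(1)] in \<open>auto simp: stores_def\<close>)
    next
      case (3 s')
      note fr = frame_vars[OF conjunct1[OF 3]]
      show ?case
        using 3 env r y out eq by (intro runs_loop_free) (auto simp: fr ready_def)
    qed auto
  next
    case (3 s')
    then show ?case
      by (intro runs_loop_free) (auto simp: ready_def addr_Suc)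
  qed
  then show ?thesis by (simp add: N_def)
qed

text \<open>The second queue lies behind the list of connected sets, hence the offset
  \<open>length ?F\<close>. An iteration is charged according to the size of its set;
  \<open>out\<close> records whether a good set is among those processed.\<close>

lemma sol_loop_runs:
  assumes s: "ready p (conn_upto k @ [{}]) s" "ivars s ''a'' = addr (length (conn_upto k))"
    "ivars s ''y'' = addr (length (conn_upto k))" "ivars s ''out'' = 0" and k: "k \<le> n"
  defines "T \<equiv> \<lambda>S. 1 + 32 * Suc n ^ 3 * length (conn_upto (k - card S))"
  shows "runs (Loop (Less (IVar ''a'') (IVar ''e'')) (sol_prog g)) s (1 + sum_list (map T (levels sol_kids {} k)))
    (\<lambda>s'. ivars s' ''out'' = of_bool (\<exists>T. solution p T))"
proof -
  let ?W = "levels sol_kids {} k" and ?F = "conn_upto k"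
  let ?q = "\<lambda>r. ?F @ queue sol_kids {} ?W r"
  let ?good = "\<lambda>S. card S = k \<and> at_least g (dval S) (2 * of_int p)"
  let ?P = "\<lambda>r s'. ready p (?q r) s' \<and> ivars s' ''a'' = addr (length ?F + r) \<and> ivars s' ''y'' = addr (length ?F) \<and>
    ivars s' ''out'' = of_bool (\<exists>S \<in> set (take r ?W). ?good S)"
  have "runs (Loop (Less (IVar ''a'') (IVar ''e'')) (sol_prog g)) s
    (1 + (\<Sum>r<length ?W. 1 + 32 * Suc n ^ 3 * length (conn_upto (k - card (?W ! r))))) (?P (length ?W))"
  proof (rule runs_Loop[where P = ?P], goal_cases)
    case 1
    show ?case using s by (simp add: queue_0)
  next
    case (2 r s')
    have r: "r < length (queue sol_kids {} ?W r)"
      by (rule queue_nonempty[OF sol_unfold _ 2(1), where rank = card])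
        (auto dest!: sol_kid[OF conjunct1[OF sol_subset]])
    then have nth: "?q r ! (length ?F + r) = ?W ! r"
      using queue_nth[OF sol_unfold] by simp
    have "card (?W ! r) \<le> k" using 2(1) sol_subset by simp
    then have "runs (sol_prog g) s' (32 * Suc n ^ 3 * length (conn_upto (k - card (?q r ! (length ?F + r))))) (?P (Suc r))"
      by (intro runs_mono[OF sol_prog_runs[where r = "length ?F + r" and L = "?q r" and s = s' and p = p
            and c = "\<exists>S \<in> set (take r ?W). ?good S"] order_refl])
        (use 2 r k nth in \<open>auto simp: queue_Suc take_Suc_conv_app_nth simp del: upt_Suc\<close>)
    moreover have "tval (Less (IVar ''a'') (IVar ''e'')) s'"
      using 2 r addr_less_iff[of "length ?F + r" "length (?q r)"] by (simp add: ready_def)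
    ultimately show ?case
      unfolding nth by blast
  next
    case (3 s')
    then show ?case by (simp add: queue_length[OF sol_unfold] ready_def)
  qed
  moreover have "(\<Sum>r<length ?W. T (?W ! r)) = sum_list (map T ?W)"
    by (simp add: sum_list_sum_nth atLeast0LessThan)
  ultimately show ?thesis
    unfolding T_def by (elim runs_mono) (auto simp: solution_iff)
qed

end

lemma square_runs:
  assumes s: "ivars s ''n'' = int n" "ivars s ''z'' = 0"
  shows "runs (For ''u'' (Incr ''z'' (IVar ''n''))) s (2 + n * 3)
    (\<lambda>s'. frame {''u'', ''z''} s s' \<and> mem s' = mem s \<and> ivars s' ''z'' = int (n * n))"
proof -
  let ?P = "\<lambda>i s'. frame {''u'', ''z''} s s' \<and> mem s' = mem s \<and> ivars s' ''z'' = int (i * n)"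
  have "runs (For ''u'' (Incr ''z'' (IVar ''n''))) s (2 + n * (1 + 2)) (?P n)"
  proof (rule runs_For[OF s(1), where P = ?P], goal_cases)
    case (3 i s')
    then show ?case by (intro runs_loop_free) (auto simp: frame_def algebra_simps)
  qed (use s in \<open>auto simp: frame_def\<close>)
  then show ?thesis by (rule runs_mono) auto
qed

section \<open>Initial memory and summation of the running times\<close>

context lgp
begin

lemma stores_initial:
  assumes "num_verts I = n" "edges I = E"
  shows "stores (mem (initial_state \<alpha>1 \<alpha>2 I)) [{}]"
proof -
  let ?m = "mem (initial_state \<alpha>1 \<alpha>2 I)"
  have "?m (int (u * n) + int v) = of_bool (adj u v)" if "u < n" "v < n" for u v
  proof -
    \<comment> \<open>Division with remainder by \<open>n\<close> recovers row and column from the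
      address.\<close>
    have "i = u \<and> j = v" if "int (u * n) + int v = int (i * n + j)" "j < n" for i j
    proof -
      from that have "u * n + v = i * n + j" by linarith
      then have "(u * n + v) div n = (i * n + j) div n" "(u * n + v) mod n = (i * n + j) mod n" by simp_all
      with that(2) \<open>v < n\<close> show ?thesis by simp
    qed
    with that show ?thesis
      unfolding initial_state_def assms adj_def by (auto simp: of_bool_def)
  qed
  \<comment> \<open>All matrix cells lie below \<open>addr 0\<close>, so the first record consists
    of zeros and represents the empty set.\<close>
  moreover have "?m x = 0" if "addr 0 \<le> x" for x
    using that matrix_less[of _ _ 0] unfolding initial_state_def assms by fastforce
  moreover have "addr 0 \<le> addr 1" by (rule addr_mono) simp
  ultimately show ?thesis
    by (auto simp: stores_def adj_matrix_def is_record_def)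
qed

lemma conn_time:
  assumes "k \<le> n"
  shows "length (conn_upto (k - j)) \<le> Suc n ^ 2 * M ^ (k - j)"
proof -
  have "Suc n * Suc (k - j) * M ^ (k - j) \<le> Suc n * Suc n * M ^ (k - j)"
    using assms by (intro mult_le_mono) auto
  with length_conn_upto[of "k - j"] show ?thesis
    unfolding power2_eq_square by (rule order_trans)
qed

text \<open>Level \<open>j\<close> has at most \<open>2 * M ^ (2 * j)\<close> sets, each costing
  \<open>M ^ (k - j)\<close> up to a polynomial factor. The product \<open>M ^ (k + j)\<close> stays
  within \<open>M ^ (2 * k)\<close>, and summing over the levels costs another factor
  \<open>Suc n\<close>.\<close>

lemma sol_time:
  assumes "k \<le> n"
  shows "sum_list (map (\<lambda>S. 1 + 32 * Suc n ^ 3 * length (conn_upto (k - card S))) (levels sol_kids {} k))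
    \<le> 66 * Suc n ^ 6 * M ^ (2 * k)"
proof -
  let ?T = "\<lambda>j. 1 + 32 * Suc n ^ 3 * length (conn_upto (k - j))"
  have "sum_list (map (\<lambda>S. ?T (card S)) (level sol_kids {} j)) \<le> 66 * Suc n ^ 5 * M ^ (2 * k)" if "j \<le> k" for j
  proof -
    have "map (\<lambda>S. ?T (card S)) (level sol_kids {} j) = map (\<lambda>_. ?T j) (level sol_kids {} j)"
      using sol_level by (intro map_cong) auto
    then have "sum_list (map (\<lambda>S. ?T (card S)) (level sol_kids {} j)) = length (level sol_kids {} j) * ?T j"
      by (simp only: sum_list_triv of_nat_id)
    also have "\<dots> \<le> (2 * M ^ (2 * j)) * (33 * Suc n ^ 5 * M ^ (k - j))"
    proof (rule mult_le_mono[OF length_sol_level])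
      have "32 * Suc n ^ 3 * length (conn_upto (k - j)) \<le> 32 * Suc n ^ 3 * (Suc n ^ 2 * M ^ (k - j))"
        by (intro mult_le_mono2 conn_time assms)
      also have "\<dots> = 32 * (Suc n ^ 5 * M ^ (k - j))"
        by (simp add: power_add[symmetric] mult.assoc[symmetric] del: power_Suc)
      finally have "32 * Suc n ^ 3 * length (conn_upto (k - j)) \<le> 32 * (Suc n ^ 5 * M ^ (k - j))" .
      moreover have "1 \<le> Suc n ^ 5 * M ^ (k - j)"
        using M_ge_1 mult_le_mono[of 1 "Suc n ^ 5" 1 "M ^ (k - j)"] by simp
      ultimately show "?T j \<le> 33 * Suc n ^ 5 * M ^ (k - j)"
        by linarith
    qed
    also have "\<dots> = 66 * Suc n ^ 5 * M ^ (2 * j + (k - j))"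
      by (simp add: power_add algebra_simps)
    also have "\<dots> \<le> 66 * Suc n ^ 5 * M ^ (2 * k)"
      using that M_ge_1 by (intro mult_le_mono2 power_increasing) auto
    finally show ?thesis .
  qed
  then have "sum_list (map (\<lambda>S. ?T (card S)) (levels sol_kids {} k)) \<le> (\<Sum>j\<le>k. 66 * Suc n ^ 5 * M ^ (2 * k))"
    unfolding sum_list_levels by (intro sum_mono) auto
  also have "\<dots> = Suc k * (66 * Suc n ^ 5 * M ^ (2 * k))"
    by simp
  also have "\<dots> \<le> Suc n * (66 * Suc n ^ 5 * M ^ (2 * k))"
    using assms by (intro mult_le_mono1) simp
  also have "\<dots> = 66 * Suc n ^ 6 * M ^ (2 * k)"
    using power_add[of "Suc n" 1 5] by (simp add: mult_ac del: mult_Suc mult_Suc_right)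
  finally show ?thesis .
qed

lemma main_prog_runs:
  assumes I: "num_verts I = n" "edges I = E" "sol_size I = int k" and k: "k \<le> n"
  shows "runs (main_prog g) (initial_state \<alpha>1 \<alpha>2 I) (100 * Suc n ^ 6 * M ^ (2 * k))
    (\<lambda>s. ivars s ''out'' = of_bool (lgp_yes g \<alpha>1 \<alpha>2 I))"
proof -
  let ?s = "initial_state \<alpha>1 \<alpha>2 I" and ?F = "conn_upto k" and ?p = "threshold I"
  let ?T1 = "1 + (\<Sum>r<length ?F. 1 + 13 * Suc n ^ 2)"
  let ?T2 = "1 + sum_list (map (\<lambda>S. 1 + 32 * Suc n ^ 3 * length (conn_upto (k - card S))) (levels sol_kids {} k))"
  let ?P = "\<lambda>s. frame {''u'', ''z''} ?s s \<and> mem s = mem ?s \<and> ivars s ''z'' = int (n * n)"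
  let ?Q = "\<lambda>s. ivars s ''out'' = of_bool (\<exists>T. solution ?p T)"
  have vars: "ivars ?s ''n'' = int n" "ivars ?s ''z'' = 0" "ivars ?s ''k'' = int k" "ivars ?s ''p'' = ?p" "ivars ?s ''out'' = 0"
    "rvars ?s ''alpha1'' = \<alpha>1" "rvars ?s ''alpha2'' = \<alpha>2"
    using I by (simp_all add: initial_state_def)
  have "runs (main_prog g) ?s ((2 + n * 3) + (1 + (3 + (?T1 + (2 + ?T2))))) ?Q"
    unfolding main_prog_def
  proof (rule runs_Seq[OF square_runs _ order_refl], goal_cases)
    case (3 s)
    note fr = frame_vars[OF conjunct1[OF 3]]
    have z: "int (n * n) = addr 0" by (simp add: addr_def)
    let ?s1 = "result (IAssign ''a'' (IVar ''z'') ;; IAssign ''e'' (IVar ''z'') ;; Next ''e'') s"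
    have s1: "ready ?p [{}] ?s1" "ivars ?s1 ''a'' = addr 0" "ivars ?s1 ''out'' = 0"
      using 3 vars stores_initial[OF I(1,2)] addr_Suc[of 0] unfolding z by (auto simp: ready_def fr)
    show ?case
    proof (rule runs_Cond, goal_cases)
      case 1
      show ?case
      proof (rule runs_Seq_loop_free[OF _ runs_Seq[OF conn_loop_runs[OF s1] runs_Seq_loop_free[where T = ?T2, OF _ _ order_refl] order_refl]], goal_cases)
        case (3 s2)
        let ?s3 = "result (IAssign ''y'' (IVar ''e'') ;; Next ''e'') s2"
        \<comment> \<open>The zeros behind the list already form the root of the second
          search.\<close>
        have "stores (mem s2) (?F @ [{}])"
          using 3 addr_less[of "length ?F" "Suc (length ?F)"]
          by (intro stores_snoc[of "mem s2"]) (auto simp: ready_def stores_def is_record_def)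
        then have s3: "ready ?p (?F @ [{}]) ?s3" "ivars ?s3 ''a'' = addr (length ?F)"
          "ivars ?s3 ''y'' = addr (length ?F)" "ivars ?s3 ''out'' = 0"
          using 3 addr_Suc[of "length ?F"] by (auto simp: ready_def)
        show ?case by (rule sol_loop_runs[OF s3 k])
      qed auto
    next
      case 2
      with vars k show ?case by (simp add: fr)
    qed
  qed (use vars in auto)
  then show ?thesis
  proof (rule runs_mono)
    have M: "1 \<le> M ^ (2 * k)" using M_ge_1 by simp
    have "length ?F * (1 + 13 * Suc n ^ 2) \<le> (Suc n ^ 2 * M ^ k) * (14 * Suc n ^ 2)"
      using conn_time[OF k, of 0] by (intro mult_le_mono) auto
    also have "\<dots> = 14 * Suc n ^ 4 * M ^ k"
      using power_add[of "Suc n" 2 2] by (simp add: mult_ac del: mult_Suc mult_Suc_right)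
    also have "\<dots> \<le> 14 * Suc n ^ 6 * M ^ (2 * k)"
      using M_ge_1 by (intro mult_le_mono power_increasing) auto
    finally have 1: "length ?F * (1 + 13 * Suc n ^ 2) \<le> 14 * (Suc n ^ 6 * M ^ (2 * k))"
      by simp
    \<comment> \<open>The coefficients 14 and 66 of the two searches leave 20 for the remaining
      terms, which are at most \<open>10 * Suc n\<close>.\<close>
    have "Suc n ^ 1 \<le> Suc n ^ 6" by (rule power_increasing) auto
    with M have "Suc n * 1 \<le> Suc n ^ 6 * M ^ (2 * k)" by (intro mult_le_mono) auto
    with 1 sol_time[OF k]
    show "(2 + n * 3) + (1 + (3 + (?T1 + (2 + ?T2)))) \<le> 100 * Suc n ^ 6 * M ^ (2 * k)"
      by (simp add: mult.assoc del: power_Suc)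
  qed (simp add: solution_yes[OF I])
qed

end

section \<open>The bound in terms of the input size\<close>

theorem theorem7:
  fixes g :: goal and \<alpha>1 \<alpha>2 :: real
  shows "solvable_in_O_star g \<alpha>1 \<alpha>2
    (\<lambda>I. (max_degree {..<num_verts I} (edges I) * nat (sol_size I)) ^ (2 * nat (sol_size I)))"
  unfolding solvable_in_O_star_def
\<comment> \<open>The second witness is the polynomial \<open>100 * (1 + x) ^ 6\<close>.\<close>
proof (rule exI[of _ "main_prog g"], rule exI[of _ "[:100:] * [:1, 1:] ^ 6"], intro allI impI)
  fix I :: lgp_input
  assume valid: "valid_input I"
  let ?n = "num_verts I" and ?k = "nat (sol_size I)" and ?s = "initial_state \<alpha>1 \<alpha>2 I"
  let ?f = "(max_degree {..<?n} (edges I) * ?k) ^ (2 * ?k)"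
  interpret lgp ?n "edges I" ?k g \<alpha>1 \<alpha>2
    using valid by unfold_locales (simp add: valid_input_def)
  \<comment> \<open>If \<open>\<Delta> * ?k = 0\<close>, both sides are 1, whether \<open>?f\<close>
    is \<open>0 ^ 0\<close> or a positive power of 0.\<close>
  have M: "M ^ (2 * ?k) = max 1 ?f"
  proof (cases "\<Delta> * ?k = 0")
    case False
    then have "1 \<le> \<Delta> * ?k" by linarith
    then have "M = \<Delta> * ?k" "1 \<le> ?f" unfolding M_def by (simp_all only: max_absorb2 one_le_power)
    then show ?thesis by (simp only: max_absorb2)
  qed (auto simp: M_def power_0_left)
  have "runs (main_prog g) ?s (100 * Suc ?n ^ 6 * M ^ (2 * ?k)) (\<lambda>s. ivars s ''out'' = of_bool (lgp_yes g \<alpha>1 \<alpha>2 I))"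
  \<comment> \<open>A size outside this range admits no feasible set, and the program stops with
    \<open>out = 0\<close> after computing \<open>z\<close>.\<close>
  proof (cases "0 \<le> sol_size I \<and> sol_size I \<le> int ?n")
    case True
    then show ?thesis by (intro main_prog_runs) auto
  next
    case False
    have no: "\<not> lgp_yes g \<alpha>1 \<alpha>2 I"
    proof
      assume "lgp_yes g \<alpha>1 \<alpha>2 I"
      then obtain T where "T \<subseteq> {..<?n}" "int (card T) = sol_size I"
        by (auto simp: lgp_yes_def)
      with False card_mono[of "{..<?n}" T] show False by auto
    qed
    have vars: "ivars ?s ''n'' = int ?n" "ivars ?s ''z'' = 0" "ivars ?s ''k'' = sol_size I" "ivars ?s ''out'' = 0"
      by (simp_all add: initial_state_def)
    have "runs (main_prog g) ?s ((2 + ?n * 3) + (1 + 1)) (\<lambda>s. ivars s ''out'' = of_bool (lgp_yes g \<alpha>1 \<alpha>2 I))"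
      unfolding main_prog_def
    proof (rule runs_Seq[OF square_runs _ order_refl], goal_cases)
      case (3 s)
      note fr = frame_vars[OF conjunct1[OF 3]]
      show ?case
        by (rule runs_Cond; rule runs_loop_free) (use vars no False in \<open>auto simp: fr\<close>)
    qed (use vars in auto)
    then show ?thesis
    proof (rule runs_mono)
      have "Suc ?n ^ 1 \<le> Suc ?n ^ 6" by (rule power_increasing) auto
      then have "Suc ?n * 1 \<le> Suc ?n ^ 6 * M ^ (2 * ?k)"
        using M_ge_1 by (intro mult_le_mono) auto
      then show "(2 + ?n * 3) + (1 + 1) \<le> 100 * Suc ?n ^ 6 * M ^ (2 * ?k)"
        by (simp add: mult.assoc del: power_Suc)
    qed
  qed
  then obtain t s where t: "exec (main_prog g) ?s t s" "t \<le> 100 * Suc ?n ^ 6 * M ^ (2 * ?k)"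
    and out: "ivars s ''out'' = of_bool (lgp_yes g \<alpha>1 \<alpha>2 I)"
    by (auto simp: runs_def)
  \<comment> \<open>The adjacency matrix alone contributes \<open>?n ^ 2\<close> to the input
    size.\<close>
  have "?n \<le> ?n ^ 2" by (simp add: power2_eq_square)
  then have "?n \<le> input_size I" by (simp add: input_size_def)
  then have "100 * Suc ?n ^ 6 \<le> 100 * Suc (input_size I) ^ 6"
    by (intro mult_le_mono2 power_mono) auto
  also have "\<dots> = poly ([:100:] * [:1, 1:] ^ 6) (input_size I)"
    by (simp add: poly_power)
  finally have "t \<le> poly ([:100:] * [:1, 1:] ^ 6) (input_size I) * max 1 ?f"
    using t(2) unfolding M by (meson mult_le_mono1 order_trans)
  with t(1) out show "\<exists>t s. exec (main_prog g) ?s t s \<and>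
      ivars s ''out'' = (if lgp_yes g \<alpha>1 \<alpha>2 I then 1 else 0) \<and>
      t \<le> poly ([:100:] * [:1, 1:] ^ 6) (input_size I) * max 1 ?f"
    by (intro exI[of _ t] exI[of _ s]) simp
qed

end
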